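(* Let $(C,(O_j)_{j\in[1..n]},L,Q)$ be a PCO specification. Algorithm G, instantiated with BR-Broadcast, implements a Process-Commutative Object specified by the tuple $(C,(O_j)_j,L,Q)$ in the system model $\mathit{BAMP}_{n,t}[t<n/3]$. That is, Algorithm G provides each correct process $p_i$ with the operations contained in $C\cup O_i\cup Q$ and, for each of its executions, represented by the corresponding history $H$: (1) all the operations invoked by correct processes terminate; and (2) there is a mock history $H'$ of $H$ such that for each correct process $p_i$ there is a PCO-legal serialization $S_i$ of $\widehat{H'}_i$, where $\widehat{H'}_i$ is $p_i$'s perceived history of $H'$.
   Context: **PCO specification.** $\Pi=\{p_1,\dots,p_n\}$ is the set of processes. A PCO (Process-Commutative Object) specification is a tuple $(C,(O_j)_{j\in[1..n]},L,Q)$. $C$ is the set of common updates, accessible to all processes and commuting with any other operation. $O_i$ is the set of updates that are exclusive to $p_i$; they do not commute with each other. Put $\Sigma=C\cup\bigcup_i O_i$ and $I=\Sigma\times\Sigma\setminus\bigcup_i(O_i\times O_i)$. Two words $u,v\in\Sigma^*$ satisfy $u\sim_I v$ iff one can be transformed into the other by exchanging adjacent letters that form a pair in $I$. $\mathbb{M}(\Sigma)=\Sigma^*/{\sim_I}$ is the trace monoid, $[u]_I$ is the class (trace) of $u$, and $\oplus$ is concatenation of words or traces; a trace is often denoted by one of its representative words. $L\subseteq\mathbb{M}(\Sigma)$ is a language of finite traces, and $Q$ is a set of query functions $q:L\to\mathbb{V}$, where $\mathbb{V}$ is a set of output values. $L$ must satisfy: *Initial emptiness*: $[\epsilon]_I\in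 L$; *$C^*$-closure*: $LC^*\subseteq L$; *$I$-diamond closure*: given $v\in L$, $\mathsf{op}_i\in O_i$ and a trace $z\in\mathbb{M}(\Sigma\setminus O_i)$, if $\{v\oplus\mathsf{op}_i,\ v\oplus z\}\subseteq L$ then $v\oplus z\oplus\mathsf{op}_i\in L$. A function $\mathsf{output}:\Sigma\times\mathbb{M}(\Sigma)\to\mathbb{V}$ gives the value $\mathsf{output}(\mathsf{up},v)$ returned by update $\mathsf{up}$ when applied to the state captured by the trace $v$. **Model $\mathit{BAMP}_{n,t}[t<n/3]$.** $n$ asynchronous processes, each pair connected by an asynchronous reliable bidirectional authenticated channel (no corruption, creation or loss of messages, arbitrary finite delays). Up to $t<n/3$ processes may be Byzantine: they behave arbitrarily, possibly colluding or controlling message delays, but remain restricted to sending and receiving messages, and cannot prevent communication between two correct processes or spawn new processes. The other processes are correct. **BR-Broadcast.** Provides an operation r-broadcast of a message $m$ with a sequence number $\mathit{sn}$, written $\langle\mathit{sn},m\rangle$, and a callback r-delivered, with: *Validity*: if a correct process $p_i$ r-delivers a message from a correct process $p_j$ with sequence number $\mathit{sn}$, then $p_j$ r-broadcast it with sequence number $\mathit{sn}$; *Integrity*: for each $\mathit{sn}$ and sender $p_j$, a correct process $p_i$ r-delivers at most one message with sequence number $\mathit{sn}$ from $p_j$; *Termination-1*: if a correct process r-broadcasts a message, it r-delivers it; *Termination-2*: if a correct process r-delivers a message from a (correct or faulty) process $p_j$, then all correct processes r-deliver it. **Algorithm G (code for $p_i$).** Local variables: $\mathit{seq}_i\in\Sigma^*$,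 initially $\epsilon$ (the sequence of updates processed so far by $p_i$); $\mathit{sn}_i\in\mathbb{N}$, initially $0$; $\mathit{del}_i[1..n]\in\mathbb{N}^n$, initially $[0,\dots,0]$. - Invoking a query $q\in Q$: return $q(\mathit{seq}_i)$. - Invoking an update $\mathsf{up}\in\Sigma$: if $\mathsf{up}\in C\cup O_i$ and $[\mathit{seq}_i\oplus\mathsf{up}]_I\in L$, then $\mathit{sn}_i\leftarrow\mathit{sn}_i+1$; r-broadcast $\langle\mathit{sn}_i,\textsc{apply}(\mathsf{up})\rangle$; wait until $\mathit{del}_i[i]=\mathit{sn}_i$ (i.e. until $p_i$ has processed its own broadcast); return $\mathsf{output}(\mathsf{up},\mathit{seq}_i)$. Otherwise raise abort (this should not happen if the application respects the tested condition). - When $\langle\mathit{sn},\textsc{apply}(\mathsf{up})\rangle$ is r-delivered from $p_j$: wait until ($\mathsf{up}\in C\cup O_j$ and $\mathit{sn}=\mathit{del}_i[j]+1$ and $[\mathit{seq}_i\oplus\mathsf{up}]_I\in L$); then $\mathit{seq}_i\leftarrow\mathit{seq}_i\oplus\mathsf{up}$; $\mathit{del}_i[j]\leftarrow\mathit{sn}$. **Histories.** A sequential execution is a sequence of invocations $e_k=(\mathsf{op},\mathit{val},p)$ with $\mathsf{op}\in\Sigma\cup Q$, $\mathit{val}\in\mathbb{V}\cup\{?\}$ and $p\in\Pi$ the invoking process, where $?\notin\mathbb{V}$ is the masked value (other values are visible). A local history $E_i$ of $p_i$ is a sequential execution in which every operation is invoked by $p_i$ and authorized to $p_i$ (it is in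 $C\cup O_i\cup Q$) and each returned value is known ($\neq\ ?$); its order is the local process order of $p_i$. A history is $H=(E_1,\dots,E_n)$, one local history per process (for a Byzantine process $E_i$ carries no meaning). A *mock history* of $H$ is $H'=(E'_1,\dots,E'_n)$ with $E'_i=E_i$ if $p_i$ is correct, and, if $p_i$ is Byzantine, $E'_i$ a sequence of updates from $O_i\cup C$ (a mock local history of $p_i$). The perceived history $\widehat{H'}_i=(\widehat{E'}_1,\dots,\widehat{E'}_n)$ has $\widehat{E'}_i=E'_i$ and, for $j\neq i$, $\widehat{E'}_j$ is obtained from $E'_j$ by removing all queries and replacing the value of each remaining update by $?$. A *serialization* of a history is a sequential execution which contains all invocations of the history and respects all local process orders. **PCO-legality.** A sequential execution $S=(e_k)_k$ is PCO-legal if: *Process Authorization*: every $(\mathsf{op},\mathit{val},p_i)\in S$ has $\mathsf{op}\in C\cup O_i\cup Q$; *Update Legality*: every prefix $u$ of the sequence of updates of $S$ satisfies $[u]_I\in L$; *Output and Query Validity*: if $e_k=(q,\mathit{val},p)$ with $q\in Q$, then $\mathit{val}=q([u_{<k}]_I)$, and if $e_k=(\mathsf{up},\mathit{val},p)$ with $\mathsf{up}\in\Sigma$ and $\mathit{val}\neq\ ?$, then $\mathit{val}=\mathsf{output}(\mathsf{up},[u_{<k}]_I)$, where $u_{<k}$ is the sequence of updates among $e_1,\dots,e_{k-1}$.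
   Formalization: In Algorithm G an update returns output(up, v) with v the value of seq_i just before p_i appends up, not seq_i at the return, which already contains up; with the latter the claim fails (single update, output = length of the trace). *)

theory Defs
  imports Complex_Main "HOL-Library.Infinite_Set" "HOL-Library.Cardinality"
begin

section \<open>PCO specifications and traces\<close>

type_synonym 'u trace = "'u list set"

text \<open>Queries are total HOL functions; only their values on the traces in \<open>lang\<close> matter.\<close>

record ('p, 'u, 'v) pco =
  common  :: "'u set"
  own     :: "'p \<Rightarrow> 'u set"
  lang    :: "'u trace set"
  queries :: "('u trace \<Rightarrow> 'v) set"

definition alphabet :: "('p, 'u, 'v) pco \<Rightarrow> 'u set" where
  "alphabet D = common D \<union> (\<Union>j. own D j)"

definition indep :: "('p, 'u, 'v) pco \<Rightarrow> ('u \<times> 'u) set" where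
  "indep D = alphabet D \<times> alphabet D - (\<Union>j. own D j \<times> own D j)"

definition swap :: "('p, 'u, 'v) pco \<Rightarrow> ('u list \<times> 'u list) set" where
  "swap D = {(x @ [a, b] @ y, x @ [b, a] @ y) | x a b y. (a, b) \<in> indep D}"

definition trc :: "('p, 'u, 'v) pco \<Rightarrow> 'u list \<Rightarrow> 'u trace" where
  "trc D w = (swap D)\<^sup>* `` {w}"

text \<open>\<open>traces D A\<close> is the set of traces whose letters all lie in \<open>A\<close>; \<open>traces D (alphabet D)\<close> is
  the trace monoid.\<close>

definition traces :: "('p, 'u, 'v) pco \<Rightarrow> 'u set \<Rightarrow> 'u trace set" where
  "traces D A = trc D ` lists A"

definition tcat :: "('p, 'u, 'v) pco \<Rightarrow> 'u trace \<Rightarrow> 'u trace \<Rightarrow> 'u trace" where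
  "tcat D X Y = (\<Union>x\<in>X. \<Union>y\<in>Y. trc D (x @ y))"

text \<open>The two disjointness clauses render ``exclusive to one process'' and ``common updates commute
  with every operation''.\<close>

definition pco_spec :: "('p, 'u, 'v) pco \<Rightarrow> bool" where
  "pco_spec D \<longleftrightarrow>
     (\<forall>i. common D \<inter> own D i = {}) \<and>
     (\<forall>i j. i \<noteq> j \<longrightarrow> own D i \<inter> own D j = {}) \<and>
     lang D \<subseteq> traces D (alphabet D) \<and>
     trc D [] \<in> lang D \<and>
     (\<forall>v\<in>lang D. \<forall>w\<in>traces D (common D). tcat D v w \<in> lang D) \<and>
     (\<forall>v\<in>lang D. \<forall>i. \<forall>u\<in>own D i. \<forall>z\<in>traces D (alphabet D - own D i).
        tcat D v (trc D [u]) \<in> lang D \<longrightarrow> tcat D v z \<in> lang D \<longrightarrow>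
        tcat D (tcat D v z) (trc D [u]) \<in> lang D)"

datatype ('u, 'v) operation = Upd 'u | Qry "'u trace \<Rightarrow> 'v"

definition ops_of :: "('p, 'u, 'v) pco \<Rightarrow> 'p \<Rightarrow> ('u, 'v) operation set" where
  "ops_of D p = Upd ` (common D \<union> own D p) \<union> Qry ` queries D"


section \<open>Sequential executions and histories\<close>

text \<open>A finite or infinite sequence is a function into \<open>option\<close> whose domain is an initial segment
  of the natural numbers.  \<open>compress\<close> closes the gaps of an arbitrary partial function on the
  natural numbers, keeping the order of the remaining entries.\<close>

type_synonym 'a seq = "nat \<Rightarrow> 'a option"

definition is_seq :: "'a seq \<Rightarrow> bool" where
  "is_seq f \<longleftrightarrow> (\<forall>i j. i \<le> j \<longrightarrow> f j \<noteq> None \<longrightarrow> f i \<noteq> None)"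

definition compress :: "(nat \<Rightarrow> 'a option) \<Rightarrow> 'a seq" where
  "compress f k =
     (if finite (dom f) \<and> card (dom f) \<le> k then None else f (enumerate (dom f) k))"

text \<open>In an invocation (operation, value, process) the masked value is \<open>None\<close>.\<close>

type_synonym ('p, 'u, 'v) invocation = "('u, 'v) operation \<times> 'v option \<times> 'p"
type_synonym ('p, 'u, 'v) history = "'p \<Rightarrow> ('p, 'u, 'v) invocation seq"

definition local_history ::
  "('p, 'u, 'v) pco \<Rightarrow> 'p \<Rightarrow> ('p, 'u, 'v) invocation seq \<Rightarrow> bool" where
  "local_history D p E \<longleftrightarrow> is_seq E \<and>
     (\<forall>k op val q. E k = Some (op, val, q) \<longrightarrow> q = p \<and> op \<in> ops_of D p \<and> val \<noteq> None)"

definition mock_local_history ::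
  "('p, 'u, 'v) pco \<Rightarrow> 'p \<Rightarrow> ('p, 'u, 'v) invocation seq \<Rightarrow> bool" where
  "mock_local_history D p E \<longleftrightarrow> is_seq E \<and>
     (\<forall>k op val q. E k = Some (op, val, q) \<longrightarrow> q = p \<and> op \<in> Upd ` (own D p \<union> common D))"

definition mock_history ::
  "('p, 'u, 'v) pco \<Rightarrow> 'p set \<Rightarrow> ('p, 'u, 'v) history \<Rightarrow> ('p, 'u, 'v) history \<Rightarrow> bool" where
  "mock_history D Byz H H' \<longleftrightarrow>
     (\<forall>p. if p \<in> Byz then mock_local_history D p (H' p) else H' p = H p)"

fun mask :: "('p, 'u, 'v) invocation \<Rightarrow> ('p, 'u, 'v) invocation option" where
  "mask (Upd u, val, p) = Some (Upd u, None, p)"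
| "mask (Qry q, val, p) = None"

definition perceived :: "'p \<Rightarrow> ('p, 'u, 'v) history \<Rightarrow> ('p, 'u, 'v) history" where
  "perceived p H = (\<lambda>j. if j = p then H j else compress (\<lambda>k. Option.bind (H j k) mask))"

text \<open>The bijection \<open>\<pi>\<close> gives the position in \<open>S\<close> of the \<open>k\<close>-th invocation of process \<open>p\<close>.\<close>

definition serialization ::
  "('p, 'u, 'v) history \<Rightarrow> ('p, 'u, 'v) invocation seq \<Rightarrow> bool" where
  "serialization H S \<longleftrightarrow> is_seq S \<and>
     (\<exists>\<pi>. bij_betw \<pi> {(p, k). H p k \<noteq> None} (dom S) \<and>
          (\<forall>p k. H p k \<noteq> None \<longrightarrow> S (\<pi> (p, k)) = H p k) \<and>
          (\<forall>p k l. k < l \<longrightarrow> H p k \<noteq> None \<longrightarrow> H p l \<noteq> None \<longrightarrow> \<pi> (p, k) < \<pi> (p, l)))"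

definition updates_before :: "('p, 'u, 'v) invocation seq \<Rightarrow> nat \<Rightarrow> 'u list" where
  "updates_before S k =
     List.map_filter (\<lambda>i. case S i of Some (Upd u, _) \<Rightarrow> Some u | _ \<Rightarrow> None) [0..<k]"

definition pco_legal ::
  "('p, 'u, 'v) pco \<Rightarrow> ('u \<Rightarrow> 'u trace \<Rightarrow> 'v) \<Rightarrow> ('p, 'u, 'v) invocation seq \<Rightarrow> bool" where
  "pco_legal D out S \<longleftrightarrow>
     (\<forall>k op val p. S k = Some (op, val, p) \<longrightarrow> op \<in> ops_of D p) \<and>
     (\<forall>k. trc D (updates_before S k) \<in> lang D) \<and>
     (\<forall>k q val p. S k = Some (Qry q, val, p) \<longrightarrow>
        val = Some (q (trc D (updates_before S k)))) \<and>
     (\<forall>k u val p. S k = Some (Upd u, val, p) \<longrightarrow> val \<noteq> None \<longrightarrow>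
        val = Some (out u (trc D (updates_before S k))))"


section \<open>Algorithm G\<close>

text \<open>\<open>Other\<close> stands for r-broadcast messages that do not have the form expected by the algorithm
  (only Byzantine processes emit them).\<close>

datatype ('u, 'm) rb_msg = Apply 'u | Other 'm

text \<open>The first argument of an event is the process at which it happens.  \<open>RDeliver p j n m\<close>:
  \<open>p\<close> r-delivers message \<open>m\<close> with sequence number \<open>n\<close> from \<open>j\<close>.  \<open>Process p j n u\<close>: the handler
  of such a message \<open>Apply u\<close> passes its wait statement and executes its body.  \<open>Send p q m\<close>:
  \<open>p\<close> sends \<open>m\<close> to \<open>q\<close>.  \<open>Receive q p m\<close>: \<open>q\<close> receives \<open>m\<close> from \<open>p\<close>.  \<open>Skip\<close>: nothing happens.\<close>

datatype ('p, 'u, 'v, 'm) event =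
    Invoke 'p "('u, 'v) operation"
  | Return 'p "('u, 'v) operation" 'v
  | Abort 'p "('u, 'v) operation"
  | RBroadcast 'p nat "('u, 'm) rb_msg"
  | RDeliver 'p 'p nat "('u, 'm) rb_msg"
  | Process 'p 'p nat 'u
  | Send 'p 'p 'm
  | Receive 'p 'p 'm
  | Skip

fun actor :: "('p, 'u, 'v, 'm) event \<Rightarrow> 'p option" where
  "actor (Invoke p op) = Some p"
| "actor (Return p op v) = Some p"
| "actor (Abort p op) = Some p"
| "actor (RBroadcast p n m) = Some p"
| "actor (RDeliver p j n m) = Some p"
| "actor (Process p j n u) = Some p"
| "actor (Send p q m) = Some p"
| "actor (Receive p q m) = Some p"
| "actor Skip = None"

datatype ('u, 'v) control = Idle | Invoked "('u, 'v) operation" | Waiting 'u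

text \<open>\<open>inbox\<close> holds the r-delivered messages whose handler is still at its wait statement.
  \<open>base\<close> is the value that the processed sequence had when the process applied its own latest update
  to it: the trace to which the output function refers is the state that the update is applied to, which
  does not contain the update itself.\<close>

record ('p, 'u, 'v, 'm) lstate =
  seqv  :: "'u list"
  sn    :: nat
  del   :: "'p \<Rightarrow> nat"
  ctl   :: "('u, 'v) control"
  inbox :: "('p \<times> nat \<times> ('u, 'm) rb_msg) set"
  base  :: "'u list"

definition init :: "('p, 'u, 'v, 'm) lstate" where
  "init = \<lparr>seqv = [], sn = 0, del = (\<lambda>_. 0), ctl = Idle, inbox = {}, base = []\<rparr>"

text \<open>The steps of the code of a correct process \<open>p\<close>; code between two wait statements is executed
  in one step.  \<open>Send\<close> and \<open>Receive\<close> belong to the layer below BR-Broadcast.\<close>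

inductive lstep ::
  "('p, 'u, 'v) pco \<Rightarrow> ('u \<Rightarrow> 'u trace \<Rightarrow> 'v) \<Rightarrow> 'p \<Rightarrow>
   ('p, 'u, 'v, 'm) lstate \<Rightarrow> ('p, 'u, 'v, 'm) event \<Rightarrow> ('p, 'u, 'v, 'm) lstate \<Rightarrow> bool"
  for D out p where
  invoke:
    "\<lbrakk>ctl s = Idle; op \<in> Upd ` alphabet D \<union> Qry ` queries D\<rbrakk> \<Longrightarrow>
     lstep D out p s (Invoke p op) (s\<lparr>ctl := Invoked op\<rparr>)"
| query_return:
    "\<lbrakk>ctl s = Invoked (Qry q)\<rbrakk> \<Longrightarrow>
     lstep D out p s (Return p (Qry q) (q (trc D (seqv s)))) (s\<lparr>ctl := Idle\<rparr>)"
| update_broadcast: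
    "\<lbrakk>ctl s = Invoked (Upd u); u \<in> common D \<union> own D p; trc D (seqv s @ [u]) \<in> lang D\<rbrakk> \<Longrightarrow>
     lstep D out p s (RBroadcast p (sn s + 1) (Apply u)) (s\<lparr>sn := sn s + 1, ctl := Waiting u\<rparr>)"
| update_abort:
    "\<lbrakk>ctl s = Invoked (Upd u); \<not> (u \<in> common D \<union> own D p \<and> trc D (seqv s @ [u]) \<in> lang D)\<rbrakk> \<Longrightarrow>
     lstep D out p s (Abort p (Upd u)) (s\<lparr>ctl := Idle\<rparr>)"
| update_return:
    "\<lbrakk>ctl s = Waiting u; del s p = sn s\<rbrakk> \<Longrightarrow>
     lstep D out p s (Return p (Upd u) (out u (trc D (base s)))) (s\<lparr>ctl := Idle\<rparr>)"
| deliver: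
    "lstep D out p s (RDeliver p j n m) (s\<lparr>inbox := insert (j, n, m) (inbox s)\<rparr>)"
| process:
    "\<lbrakk>(j, n, Apply u) \<in> inbox s;
      u \<in> common D \<union> own D j; n = del s j + 1; trc D (seqv s @ [u]) \<in> lang D\<rbrakk> \<Longrightarrow>
     lstep D out p s (Process p j n u)
       (s\<lparr>seqv := seqv s @ [u], del := (del s)(j := n),
          inbox := inbox s - {(j, n, Apply u)},
          base := (if j = p then seqv s else base s)\<rparr>)"
| send: "lstep D out p s (Send p q m) s"
| receive: "lstep D out p s (Receive p q m) s"

text \<open>Byzantine processes are unconstrained: their events need no enabling condition and their local
  state is arbitrary.\<close>

definition gstep ::
  "('p, 'u, 'v) pco \<Rightarrow> ('u \<Rightarrow> 'u trace \<Rightarrow> 'v) \<Rightarrow> 'p set \<Rightarrow>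
   ('p \<Rightarrow> ('p, 'u, 'v, 'm) lstate) \<Rightarrow> ('p, 'u, 'v, 'm) event \<Rightarrow>
   ('p \<Rightarrow> ('p, 'u, 'v, 'm) lstate) \<Rightarrow> bool" where
  "gstep D out Byz s e s' \<longleftrightarrow>
     (\<forall>p. p \<notin> Byz \<longrightarrow> (if actor e = Some p then lstep D out p (s p) e (s' p) else s' p = s p))"


section \<open>System model and executions\<close>

text \<open>Reliable authenticated channels: messages are neither corrupted, created nor duplicated, and
  every message sent to a correct process is eventually received.  Multiplicities are
  compared because the same content may be sent several times.\<close>

definition channels :: "'p set \<Rightarrow> (nat \<Rightarrow> ('p, 'u, 'v, 'm) event) \<Rightarrow> bool" where
  "channels Byz \<alpha> \<longleftrightarrow>
     (\<forall>p q m k. card {i. i < k \<and> \<alpha> i = Receive q p m} \<le> card {i. i < k \<and> \<alpha> i = Send p q m}) \<and>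
     (\<forall>p q m k. q \<notin> Byz \<longrightarrow>
        (\<exists>l. card {i. i < k \<and> \<alpha> i = Send p q m} \<le> card {i. i < l \<and> \<alpha> i = Receive q p m}))"

definition rb_validity :: "'p set \<Rightarrow> (nat \<Rightarrow> ('p, 'u, 'v, 'm) event) \<Rightarrow> bool" where
  "rb_validity Byz \<alpha> \<longleftrightarrow>
     (\<forall>i j n m k. i \<notin> Byz \<longrightarrow> j \<notin> Byz \<longrightarrow> \<alpha> k = RDeliver i j n m \<longrightarrow>
        (\<exists>l<k. \<alpha> l = RBroadcast j n m))"

definition rb_integrity :: "'p set \<Rightarrow> (nat \<Rightarrow> ('p, 'u, 'v, 'm) event) \<Rightarrow> bool" where
  "rb_integrity Byz \<alpha> \<longleftrightarrow>
     (\<forall>i j n m m' k l. i \<notin> Byz \<longrightarrow> \<alpha> k = RDeliver i j n m \<longrightarrow> \<alpha> l = RDeliver i j n m' \<longrightarrow> k = l)"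

definition rb_termination_1 :: "'p set \<Rightarrow> (nat \<Rightarrow> ('p, 'u, 'v, 'm) event) \<Rightarrow> bool" where
  "rb_termination_1 Byz \<alpha> \<longleftrightarrow>
     (\<forall>i n m k. i \<notin> Byz \<longrightarrow> \<alpha> k = RBroadcast i n m \<longrightarrow> (\<exists>l. \<alpha> l = RDeliver i i n m))"

definition rb_termination_2 :: "'p set \<Rightarrow> (nat \<Rightarrow> ('p, 'u, 'v, 'm) event) \<Rightarrow> bool" where
  "rb_termination_2 Byz \<alpha> \<longleftrightarrow>
     (\<forall>i i' j n m k. i \<notin> Byz \<longrightarrow> i' \<notin> Byz \<longrightarrow> \<alpha> k = RDeliver i j n m \<longrightarrow>
        (\<exists>l. \<alpha> l = RDeliver i' j n m))"

definition br_broadcast :: "'p set \<Rightarrow> (nat \<Rightarrow> ('p, 'u, 'v, 'm) event) \<Rightarrow> bool" where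
  "br_broadcast Byz \<alpha> \<longleftrightarrow>
     rb_validity Byz \<alpha> \<and> rb_integrity Byz \<alpha> \<and> rb_termination_1 Byz \<alpha> \<and> rb_termination_2 Byz \<alpha>"

text \<open>The steps of a pending operation that the process itself has to take.\<close>

fun op_event :: "'p \<Rightarrow> ('p, 'u, 'v, 'm) event \<Rightarrow> bool" where
  "op_event p (Return q op v) = (q = p)"
| "op_event p (Abort q op) = (q = p)"
| "op_event p (RBroadcast q n m) = (q = p)"
| "op_event p _ = False"

text \<open>A correct process does not stop: a pending operation, and every message handler, whose next
  step is enabled from some point on, eventually takes a step (weak fairness).\<close>

definition progress ::
  "('p, 'u, 'v) pco \<Rightarrow> ('u \<Rightarrow> 'u trace \<Rightarrow> 'v) \<Rightarrow> 'p set \<Rightarrow>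
   (nat \<Rightarrow> 'p \<Rightarrow> ('p, 'u, 'v, 'm) lstate) \<Rightarrow> (nat \<Rightarrow> ('p, 'u, 'v, 'm) event) \<Rightarrow> bool" where
  "progress D out Byz \<sigma> \<alpha> \<longleftrightarrow>
     (\<forall>p k. p \<notin> Byz \<longrightarrow>
        (\<forall>i\<ge>k. \<exists>e s'. op_event p e \<and> lstep D out p (\<sigma> i p) e s') \<longrightarrow>
        (\<exists>i\<ge>k. op_event p (\<alpha> i))) \<and>
     (\<forall>p j n u k. p \<notin> Byz \<longrightarrow>
        (\<forall>i\<ge>k. \<exists>s'. lstep D out p (\<sigma> i p) (Process p j n u) s') \<longrightarrow>
        (\<exists>i\<ge>k. \<alpha> i = Process p j n u))"

text \<open>\<open>\<alpha> k\<close> is the event leading from configuration \<open>\<sigma> k\<close> to \<open>\<sigma> (Suc k)\<close>.  A finite execution is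
  one that ends with an infinite repetition of \<open>Skip\<close>.\<close>

definition execution ::
  "('p, 'u, 'v) pco \<Rightarrow> ('u \<Rightarrow> 'u trace \<Rightarrow> 'v) \<Rightarrow> 'p set \<Rightarrow>
   (nat \<Rightarrow> 'p \<Rightarrow> ('p, 'u, 'v, 'm) lstate) \<Rightarrow> (nat \<Rightarrow> ('p, 'u, 'v, 'm) event) \<Rightarrow> bool" where
  "execution D out Byz \<sigma> \<alpha> \<longleftrightarrow>
     (\<forall>p. p \<notin> Byz \<longrightarrow> \<sigma> 0 p = init) \<and>
     (\<forall>k. gstep D out Byz (\<sigma> k) (\<alpha> k) (\<sigma> (Suc k))) \<and>
     channels Byz \<alpha> \<and> br_broadcast Byz \<alpha> \<and> progress D out Byz \<sigma> \<alpha>"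

text \<open>Aborted operations have no value and are not part of the history.\<close>

definition history_of :: "(nat \<Rightarrow> ('p, 'u, 'v, 'm) event) \<Rightarrow> ('p, 'u, 'v) history" where
  "history_of \<alpha> = (\<lambda>p. compress (\<lambda>k. case \<alpha> k of
     Return q op v \<Rightarrow> if q = p then Some (op, Some v, p) else None | _ \<Rightarrow> None))"

text \<open>Whenever \<open>p\<close> is idle it can invoke each of its operations, and an invoked update that satisfies
  the tested condition is accepted rather than aborted.\<close>

definition provides_ops ::
  "('p, 'u, 'v) pco \<Rightarrow> ('u \<Rightarrow> 'u trace \<Rightarrow> 'v) \<Rightarrow> 'p \<Rightarrow> ('p, 'u, 'v, 'm) lstate \<Rightarrow> bool" where
  "provides_ops D out p s \<longleftrightarrow>
     (ctl s = Idle \<longrightarrow> (\<forall>op\<in>ops_of D p. \<exists>s'. lstep D out p s (Invoke p op) s')) \<and>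
     (\<forall>u\<in>common D \<union> own D p. ctl s = Invoked (Upd u) \<longrightarrow> trc D (seqv s @ [u]) \<in> lang D \<longrightarrow>
        (\<exists>n s'. lstep D out p s (RBroadcast p n (Apply u)) s') \<and>
        (\<nexists>s'. lstep D out p s (Abort p (Upd u)) s'))"

text \<open>A process invokes operations one at a time, so the first response after an invocation is the
  response to that invocation.\<close>

definition ops_terminate :: "'p \<Rightarrow> (nat \<Rightarrow> ('p, 'u, 'v, 'm) event) \<Rightarrow> bool" where
  "ops_terminate p \<alpha> \<longleftrightarrow>
     (\<forall>k op. \<alpha> k = Invoke p op \<longrightarrow>
        (\<exists>l>k. (\<exists>v. \<alpha> l = Return p op v) \<or> \<alpha> l = Abort p op))"

end

theory Submission
  imports Defs "HOL-Library.Sublist"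
begin

text \<open>
By BR-Broadcast, the messages that the correct processes process from one sender form, at each of
them, a prefix of a common sequence. If the sequence \<open>v\<close> processed by \<open>p\<close> agrees with a longer
sequence processed by \<open>q\<close> in this sense, then the latter is a trace \<open>v \<oplus> z\<close>, because letters of
different senders commute. If moreover \<open>p\<close> can process an update \<open>u\<close> of \<open>j\<close> in state \<open>v\<close> and \<open>z\<close>
contains no message of \<open>j\<close>, then \<open>q\<close> can process \<open>u\<close> as well: by \<open>C\<^sup>*\<close>-closure if \<open>u\<close> is common and
by \<open>I\<close>-diamond closure otherwise. Hence every correct process eventually processes whatever another
one has processed, and its own updates never become disabled. Operations therefore terminate, and
the sequences of updates from a fixed sender agree at all correct processes, so those that one of
them has processed from the Byzantine processes serve as mock histories.
\<close>

section \<open>Gap-free enumeration of partial sequences\<close>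

text \<open>These finite prefixes replace \<open>enumerate\<close> in every argument about
  \<open>compress f\<close>: an entry \<open>f i\<close> ends up at position
  \<open>length (pre f i)\<close>, and the lists \<open>pre f k\<close> exhaust the compressed
  sequence.\<close>

definition pre :: "(nat \<Rightarrow> 'a option) \<Rightarrow> nat \<Rightarrow> 'a list" where
  "pre f k = List.map_filter f [0..<k]"

lemma pre_0 [simp]: "pre f 0 = []"
  by (simp add: pre_def)

lemma map_filter_append:
  "List.map_filter f (xs @ ys) = List.map_filter f xs @ List.map_filter f ys"
  by (simp add: List.map_filter_def)

lemma pre_Suc: "pre f (Suc k) = pre f k @ (case f k of None \<Rightarrow> [] | Some x \<Rightarrow> [x])"
  by (simp add: pre_def map_filter_append List.map_filter_simps split: option.splits)

lemma prefix_pre: "k \<le> l \<Longrightarrow> prefix (pre f k) (pre f l)"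
  by (induction l rule: dec_induct) (auto simp: pre_Suc intro: prefix_order.trans)

lemma pre_bind: "pre (\<lambda>k. Option.bind (f k) h) k = List.map_filter h (pre f k)"
  by (induction k) (auto simp: pre_Suc map_filter_append List.map_filter_simps split: option.splits)

lemma length_pre: "length (pre f k) = card {i \<in> dom f. i < k}"
proof (induction k)
  case (Suc k)
  have "{i \<in> dom f. i < Suc k} = (if f k = None then {i \<in> dom f. i < k} else insert k {i \<in> dom f. i < k})"
    by (auto simp: less_Suc_eq)
  with Suc show ?case by (auto simp: pre_Suc split: option.splits)
qed simp

lemma nth_pre_length:
  assumes "f i = Some x" "i < k"
  shows "length (pre f i) < length (pre f k) \<and> pre f k ! length (pre f i) = x"
proof -
  have "prefix (pre f i @ [x]) (pre f k)"
    using prefix_pre[of "Suc i" k f] assms by (simp add: pre_Suc)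
  then show ?thesis by (auto simp: prefix_def nth_append)
qed

lemma nth_preD:
  assumes "r < length (pre f k)"
  shows "\<exists>i<k. length (pre f i) = r \<and> f i = Some (pre f k ! r)"
  using assms
proof (induction k)
  case (Suc k)
  show ?case
  proof (cases "r < length (pre f k)")
    case True
    with Suc.IH show ?thesis by (auto simp: pre_Suc nth_append less_Suc_eq)
  next
    case False
    with Suc.prems show ?thesis
      by (intro exI[of _ k]) (auto simp: pre_Suc nth_append split: option.splits)
  qed
qed simp

text \<open>The index set is the complement of the condition under which \<open>compress\<close>
  yields \<open>None\<close>, which treats finite and infinite domains uniformly.\<close>

lemma enumerate_valid_bij:
  fixes A :: "nat set"
  shows "bij_betw (enumerate A) {k. \<not> (finite A \<and> card A \<le> k)} A"
proof (cases "finite A")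
  case True
  then show ?thesis using finite_bij_enumerate[of A] by (simp add: lessThan_def not_le)
next
  case False
  then show ?thesis using bij_enumerate[of A] by simp
qed

lemma enumerate_valid_mono:
  fixes A :: "nat set"
  assumes "m < n" "\<not> (finite A \<and> card A \<le> n)"
  shows "enumerate A m < enumerate A n"
  using assms by (cases "finite A") (auto intro: finite_enumerate_mono enumerate_mono)

text \<open>On its valid indices \<open>enumerate\<close> is a strictly increasing bijection onto
  the domain, so the defined indices below the \<open>r\<close>-th one are the images of the numbers
  below \<open>r\<close>.\<close>

lemma length_pre_enumerate:
  assumes "\<not> (finite (dom f) \<and> card (dom f) \<le> r)"
  shows "length (pre f (enumerate (dom f) r)) = r"
proof -
  let ?V = "{k. \<not> (finite (dom f) \<and> card (dom f) \<le> k)}"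
  let ?e = "enumerate (dom f)"
  have bij: "bij_betw ?e ?V (dom f)" by (rule enumerate_valid_bij)
  have sub: "{..<r} \<subseteq> ?V" using assms by auto
  have "{i \<in> dom f. i < ?e r} = ?e ` {..<r}"
  proof
    show "{i \<in> dom f. i < ?e r} \<subseteq> ?e ` {..<r}"
    proof
      fix i assume i: "i \<in> {i \<in> dom f. i < ?e r}"
      then obtain m where m: "m \<in> ?V" "i = ?e m"
        using bij unfolding bij_betw_def by auto
      have "m < r"
      proof (rule ccontr)
        assume "\<not> m < r"
        then have "?e r \<le> ?e m" using m(1) enumerate_valid_mono[of r m "dom f"]
          by (cases "m = r") auto
        with i m show False by auto
      qed
      with m show "i \<in> ?e ` {..<r}" by auto
    qed
    show "?e ` {..<r} \<subseteq> {i \<in> dom f. i < ?e r}"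
      using bij sub assms enumerate_valid_mono[of _ r "dom f"] unfolding bij_betw_def by auto
  qed
  moreover have "inj_on ?e {..<r}"
    using bij sub unfolding bij_betw_def by (blast intro: inj_on_subset)
  ultimately show ?thesis by (simp add: length_pre card_image)
qed

text \<open>Since \<open>enumerate\<close> is onto the domain, every defined index \<open>i\<close>
  is enumerated at some place, and this place is its rank \<open>length (pre f i)\<close>. Later
  proofs use this description in place of \<open>enumerate\<close>.\<close>

lemma compress_eq_Some_iff:
  "compress f r = Some x \<longleftrightarrow> (\<exists>i. f i = Some x \<and> length (pre f i) = r)"
proof -
  let ?V = "{k. \<not> (finite (dom f) \<and> card (dom f) \<le> k)}"
  let ?e = "enumerate (dom f)"
  have bij: "bij_betw ?e ?V (dom f)" by (rule enumerate_valid_bij)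
  show ?thesis
  proof
    assume "compress f r = Some x"
    then have "r \<in> ?V" "f (?e r) = Some x" by (auto simp: compress_def split: if_splits)
    then show "\<exists>i. f i = Some x \<and> length (pre f i) = r" using length_pre_enumerate[of f r] by auto
  next
    assume "\<exists>i. f i = Some x \<and> length (pre f i) = r"
    then obtain i where i: "f i = Some x" "length (pre f i) = r" by auto
    then obtain m where m: "m \<in> ?V" "i = ?e m" using bij unfolding bij_betw_def by blast
    then have "m = r" using i length_pre_enumerate[of f m] by auto
    with m i show "compress f r = Some x" by (auto simp: compress_def)
  qed
qed

lemma compress_nth:
  "compress f r = Some x \<longleftrightarrow> (\<exists>k. r < length (pre f k) \<and> pre f k ! r = x)"
proof
  assume "compress f r = Some x"
  then obtain i where "f i = Some x" "length (pre f i) = r"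
    unfolding compress_eq_Some_iff by blast
  then show "\<exists>k. r < length (pre f k) \<and> pre f k ! r = x" using nth_pre_length[of f i x "Suc i"] by auto
next
  assume "\<exists>k. r < length (pre f k) \<and> pre f k ! r = x"
  then obtain k where "r < length (pre f k)" "pre f k ! r = x" by blast
  with nth_preD[of r f k] show "compress f r = Some x" unfolding compress_eq_Some_iff by blast
qed

lemma is_seq_compress: "is_seq (compress f)"
  unfolding is_seq_def
proof (intro allI impI)
  fix i j assume "i \<le> j" "compress f j \<noteq> None"
  then obtain k where "i < length (pre f k)" using compress_nth[of f j] by (metis not_Some_eq order_le_less_trans)
  then show "compress f i \<noteq> None" using compress_nth[of f i] by (metis option.distinct(1))
qed

lemma pre_seq:
  assumes "\<And>r. r < n \<Longrightarrow> g r = Some (xs ! r)" "n = length xs"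
  shows "pre g n = xs"
proof -
  have "k \<le> n \<Longrightarrow> pre g k = take k xs" for k
    by (induction k) (auto simp: pre_Suc assms take_Suc_conv_app_nth)
  with assms(2) show ?thesis by simp
qed

lemma pre_compress_length: "pre (compress f) (length (pre f l)) = pre f l"
  by (rule pre_seq) (auto simp: compress_nth)

lemma pre_compress: "\<exists>l. pre (compress f) k = pre f l"
proof (induction k)
  case 0
  then show ?case by (auto intro: exI[of _ 0])
next
  case (Suc k)
  show ?case
  proof (cases "compress f k")
    case None
    with Suc show ?thesis by (simp add: pre_Suc)
  next
    case (Some x)
    then obtain l where l: "f l = Some x" "length (pre f l) = k"
      by (auto simp: compress_eq_Some_iff)
    then have "length (pre f (Suc l)) = Suc k" by (simp add: pre_Suc)
    then show ?thesis using pre_compress_length[of f "Suc l"] by auto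
  qed
qed

text \<open>Legality relates an invocation to the updates before it, so one index \<open>l\<close>
  has to account for both the entry and the list preceding it.\<close>

lemma pre_compress_Some:
  assumes "compress f k = Some x"
  shows "\<exists>l. f l = Some x \<and> pre (compress f) k = pre f l"
  using assms pre_compress_length[of f] by (auto simp: compress_eq_Some_iff)

text \<open>The entry at position \<open>r\<close> can be read off any prefix longer than
  \<open>r\<close>. Hence mutual domination of prefixes suffices, even if the entries occur at
  different times in \<open>f\<close> and \<open>g\<close>.\<close>

lemma compress_cong:
  assumes "\<And>k. \<exists>l. prefix (pre f k) (pre g l)" "\<And>k. \<exists>l. prefix (pre g k) (pre f l)"
  shows "compress f = compress g"
proof -
  have *: "compress g r = Some x"
    if lim: "compress f r = Some x" "\<And>k. \<exists>l. prefix (pre f k) (pre g l)" for f g :: "nat \<Rightarrow> 'a option" and r x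
  proof -
    obtain k where k: "r < length (pre f k)" "pre f k ! r = x"
      using lim(1) unfolding compress_nth by blast
    obtain l zs where "pre g l = pre f k @ zs" using lim(2)[of k] unfolding prefix_def by blast
    with k have "r < length (pre g l) \<and> pre g l ! r = x" by (simp add: nth_append)
    then show ?thesis unfolding compress_nth by blast
  qed
  show ?thesis
  proof
    fix r show "compress f r = compress g r"
      using *[of f r _ g, OF _ assms(1)] *[of g r _ f, OF _ assms(2)]
      by (cases "compress f r"; cases "compress g r") auto
  qed
qed

text \<open>\<open>perceived\<close> masks a history that is itself compressed; this removes the
  inner \<open>compress\<close>.\<close>

lemma compress_bind_compress:
  "compress (\<lambda>k. Option.bind (compress f k) h) = compress (\<lambda>k. Option.bind (f k) h)"
proof (rule compress_cong; unfold pre_bind)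
  show "\<exists>l. prefix (List.map_filter h (pre (compress f) k)) (List.map_filter h (pre f l))" for k
    using pre_compress[of f k] by auto
  show "\<exists>l. prefix (List.map_filter h (pre f k)) (List.map_filter h (pre (compress f) l))" for k
    using pre_compress_length[of f k] by (metis prefix_order.refl)
qed

section \<open>Serializing the projections of one timeline\<close>

definition part :: "'p \<Rightarrow> (nat \<Rightarrow> ('p, 'u, 'v) invocation option) \<Rightarrow> nat \<Rightarrow> ('p, 'u, 'v) invocation option" where
  "part q G k = Option.bind (G k) (\<lambda>e. if snd (snd e) = q then Some e else None)"

lemma part_Some [simp]: "part q G k = Some e \<longleftrightarrow> G k = Some e \<and> snd (snd e) = q"
  by (cases "G k") (auto simp: part_def)

lemma length_pre_inj:
  assumes "f i \<noteq> None" "f k \<noteq> None" "length (pre f i) = length (pre f k)"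
  shows "i = k"
  using assms nth_pre_length[of f i _ k] nth_pre_length[of f k _ i]
  by (metis less_irrefl linorder_neqE_nat not_Some_eq)

lemma length_pre_mono:
  "f i \<noteq> None \<Longrightarrow> i < k \<Longrightarrow> length (pre f i) < length (pre f k)"
  using nth_pre_length[of f i _ k] by auto

text \<open>Each local invocation occupies an index of the common timeline \<open>G\<close>. Its
  place in the serialization is the rank of that index in \<open>G\<close>, its local place the rank
  of the same index in the projection; both ranks increase with the index.\<close>

lemma serialization_compress:
  fixes G :: "nat \<Rightarrow> ('p, 'u, 'v) invocation option"
  shows "serialization (\<lambda>q. compress (part q G)) (compress G)"
proof -
  let ?X = "{(q, k). compress (part q G) k \<noteq> None}"
  \<comment> \<open>The index in \<open>G\<close> of the \<open>k\<close>-th invocation of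
    \<open>q\<close>; it is unique because ranks of defined indices are distinct.\<close>
  define pos where "pos x = (SOME i. part (fst x) G i \<noteq> None \<and> length (pre (part (fst x) G) i) = snd x)"
    for x :: "'p \<times> nat"
  define \<pi> where "\<pi> x = length (pre G (pos x))" for x
  have pos: "part q G (pos (q, k)) = compress (part q G) k \<and> length (pre (part q G) (pos (q, k))) = k"
    if nn: "compress (part q G) k \<noteq> None" for q k
  proof -
    obtain e where e: "compress (part q G) k = Some e" using nn by blast
    then obtain i where i: "part q G i = Some e" "length (pre (part q G) i) = k"
      unfolding compress_eq_Some_iff by blast
    then have "\<exists>i. part q G i \<noteq> None \<and> length (pre (part q G) i) = k" by (metis option.distinct(1))
    then have *: "part q G (pos (q, k)) \<noteq> None \<and> length (pre (part q G) (pos (q, k))) = k"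
      unfolding pos_def fst_conv snd_conv by (rule someI_ex)
    then have "pos (q, k) = i" using length_pre_inj[of "part q G" "pos (q, k)" i] i by auto
    with * i e show ?thesis by simp
  qed
  have G: "G (pos (q, k)) = compress (part q G) k" "snd (snd (the (G (pos (q, k))))) = q"
    if nn: "compress (part q G) k \<noteq> None" for q k
  proof -
    obtain e where e: "compress (part q G) k = Some e" using nn by blast
    with pos[OF nn] have "part q G (pos (q, k)) = Some e" by simp
    with e show "G (pos (q, k)) = compress (part q G) k" "snd (snd (the (G (pos (q, k))))) = q" by auto
  qed
  have S: "compress G (\<pi> (q, k)) = compress (part q G) k" if nn: "compress (part q G) k \<noteq> None" for q k
  proof -
    obtain e where e: "compress (part q G) k = Some e" using nn by blast
    then have "G (pos (q, k)) = Some e" using G(1)[OF nn] by simp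
    then have "compress G (\<pi> (q, k)) = Some e" unfolding \<pi>_def compress_eq_Some_iff by blast
    with e show ?thesis by simp
  qed
  \<comment> \<open>Equal ranks in \<open>G\<close> mean equal indices. The invocation found there
    names its process, and its rank in the projection of that process gives back the local
    position.\<close>
  have "inj_on \<pi> ?X"
  proof (rule inj_onI)
    fix x y assume x: "x \<in> ?X" and y: "y \<in> ?X" and eq: "\<pi> x = \<pi> y"
    obtain q k where xq: "x = (q, k)" by fastforce
    obtain r l where yr: "y = (r, l)" by fastforce
    have nn: "compress (part q G) k \<noteq> None" "compress (part r G) l \<noteq> None"
      using x y xq yr by simp_all
    have "pos (q, k) = pos (r, l)"
    proof (rule length_pre_inj)
      show "G (pos (q, k)) \<noteq> None" "G (pos (r, l)) \<noteq> None"
        using G(1)[OF nn(1)] G(1)[OF nn(2)] nn by simp_all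
      show "length (pre G (pos (q, k))) = length (pre G (pos (r, l)))"
        using eq xq yr by (simp add: \<pi>_def)
    qed
    with G(2)[OF nn(1)] G(2)[OF nn(2)] pos[OF nn(1)] pos[OF nn(2)] show "x = y"
      unfolding xq yr by (metis (full_types))
  qed
  moreover have "\<pi> ` ?X = dom (compress G)"
  proof
    show "\<pi> ` ?X \<subseteq> dom (compress G)" using S by auto
    show "dom (compress G) \<subseteq> \<pi> ` ?X"
    proof
      fix m assume "m \<in> dom (compress G)"
      then obtain e i where e: "G i = Some e" "length (pre G i) = m" by (auto simp: compress_eq_Some_iff)
      define q where "q = snd (snd e)"
      define k where "k = length (pre (part q G) i)"
      have p: "part q G i = Some e" using e by (simp add: q_def)
      then have c: "compress (part q G) k = Some e" by (auto simp: compress_eq_Some_iff k_def)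
      then have nn: "compress (part q G) k \<noteq> None" by simp
      have "pos (q, k) = i"
      proof (rule length_pre_inj)
        show "part q G (pos (q, k)) \<noteq> None" using pos[OF nn] nn by simp
        show "part q G i \<noteq> None" using p by simp
        show "length (pre (part q G) (pos (q, k))) = length (pre (part q G) i)"
          using pos[OF nn] by (simp only: k_def)
      qed
      then have "\<pi> (q, k) = m" using e by (simp add: \<pi>_def)
      moreover have "(q, k) \<in> ?X" using nn by simp
      ultimately show "m \<in> \<pi> ` ?X" by blast
    qed
  qed
  moreover have "\<pi> (q, k) < \<pi> (q, l)"
    if "k < l" "compress (part q G) k \<noteq> None" "compress (part q G) l \<noteq> None" for q k l
  proof -
    \<comment> \<open>Lengths of prefixes grow with the index, so the larger local position cannot
      have the smaller index.\<close>
    have "\<not> pos (q, l) \<le> pos (q, k)"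
    proof
      assume "pos (q, l) \<le> pos (q, k)"
      then have "length (pre (part q G) (pos (q, l))) \<le> length (pre (part q G) (pos (q, k)))"
        by (intro prefix_length_le prefix_pre)
      with pos[OF that(2)] pos[OF that(3)] that(1) show False by simp
    qed
    moreover have "G (pos (q, k)) \<noteq> None" using G(1)[OF that(2)] that(2) by simp
    ultimately show ?thesis unfolding \<pi>_def by (simp add: length_pre_mono)
  qed
  ultimately show ?thesis
    unfolding serialization_def bij_betw_def
    by (intro conjI exI[of _ \<pi>] is_seq_compress allI impI S) auto
qed

lemma updates_before_pre:
  "updates_before S k = List.map_filter (\<lambda>e. case e of (Upd u, _) \<Rightarrow> Some u | _ \<Rightarrow> None) (pre S k)"
proof -
  have *: "(\<lambda>i. case S i of Some (Upd u, _) \<Rightarrow> Some u | _ \<Rightarrow> None) =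
    (\<lambda>k. Option.bind (S k) (\<lambda>e. case e of (Upd u, _) \<Rightarrow> Some u | _ \<Rightarrow> None))"
    by (auto split: option.splits prod.splits operation.splits)
  show ?thesis unfolding updates_before_def * pre_bind[symmetric] by (simp add: pre_def)
qed

section \<open>Traces\<close>

lemma indep_sym: "(a, b) \<in> indep D \<Longrightarrow> (b, a) \<in> indep D"
  by (auto simp: indep_def)

lemma swap_sym: "sym (swap D)"
proof (rule symI)
  fix x y assume "(x, y) \<in> swap D"
  then obtain p a b q where "x = p @ [a, b] @ q" "y = p @ [b, a] @ q" "(b, a) \<in> indep D"
    unfolding swap_def using indep_sym by fast
  then show "(y, x) \<in> swap D" unfolding swap_def by blast
qed

text \<open>\<open>trc\<close> is defined by reachability; symmetry of \<open>swap\<close> turns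
  reachability into an equivalence, so that traces are its classes.\<close>

lemma trc_eq_iff: "trc D x = trc D y \<longleftrightarrow> (x, y) \<in> (swap D)\<^sup>*"
proof
  assume "trc D x = trc D y" then show "(x, y) \<in> (swap D)\<^sup>*" by (auto simp: trc_def)
next
  assume a: "(x, y) \<in> (swap D)\<^sup>*"
  then have "(y, x) \<in> (swap D)\<^sup>*" using swap_sym by (metis sym_rtrancl symD)
  with a show "trc D x = trc D y" unfolding trc_def by (auto intro: rtrancl_trans)
qed

lemma swap_context: "(x, y) \<in> swap D \<Longrightarrow> (u @ x @ v, u @ y @ v) \<in> swap D"
proof -
  assume "(x, y) \<in> swap D"
  then obtain p a b q where xy: "x = p @ [a, b] @ q" "y = p @ [b, a] @ q" "(a, b) \<in> indep D"
    unfolding swap_def by blast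
  have "u @ x @ v = (u @ p) @ [a, b] @ q @ v" "u @ y @ v = (u @ p) @ [b, a] @ q @ v"
    using xy by simp_all
  with xy(3) show "(u @ x @ v, u @ y @ v) \<in> swap D" unfolding swap_def by blast
qed

lemma swap_rtrancl_context:
  "(x, y) \<in> (swap D)\<^sup>* \<Longrightarrow> (u @ x @ v, u @ y @ v) \<in> (swap D)\<^sup>*"
  by (induction rule: rtrancl_induct) (blast intro: rtrancl_into_rtrancl swap_context)+

lemma trc_cong_append:
  assumes "trc D x = trc D x'" "trc D y = trc D y'"
  shows "trc D (x @ y) = trc D (x' @ y')"
proof -
  have "(x @ y, x' @ y) \<in> (swap D)\<^sup>*" "(x' @ y, x' @ y') \<in> (swap D)\<^sup>*"
    using assms swap_rtrancl_context[of x x' D "[]" y] swap_rtrancl_context[of y y' D x' "[]"]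
    by (simp_all add: trc_eq_iff)
  then show ?thesis unfolding trc_eq_iff by (rule rtrancl_trans)
qed

lemma mem_trc_iff: "x' \<in> trc D x \<longleftrightarrow> trc D x = trc D x'"
  unfolding trc_eq_iff by (simp add: trc_def)

text \<open>By congruence all concatenations of representatives lie in one class, so the union in
  \<open>tcat\<close> collapses. This allows working with words from here on.\<close>

lemma tcat_trc: "tcat D (trc D x) (trc D y) = trc D (x @ y)"
proof
  have "trc D (x' @ y') = trc D (x @ y)" if "x' \<in> trc D x" "y' \<in> trc D y" for x' y'
    using that by (intro trc_cong_append) (simp_all add: mem_trc_iff)
  then show "tcat D (trc D x) (trc D y) \<subseteq> trc D (x @ y)" unfolding tcat_def by blast
  have "x \<in> trc D x" "y \<in> trc D y" by (simp_all add: mem_trc_iff)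
  then show "trc D (x @ y) \<subseteq> tcat D (trc D x) (trc D y)" unfolding tcat_def by blast
qed

text \<open>Updates are paired with their senders because a common update does not reveal who issued
  it.\<close>

definition authorized :: "('p, 'u, 'v) pco \<Rightarrow> 'p \<times> 'u \<Rightarrow> bool" where
  "authorized D x \<longleftrightarrow> snd x \<in> common D \<union> own D (fst x)"

section \<open>The axioms of the specification on words, and words that agree sender by
  sender\<close>

lemma common_not_own: "pco_spec D \<Longrightarrow> u \<in> common D \<Longrightarrow> u \<notin> own D i"
  unfolding pco_spec_def by (meson disjoint_iff)

lemma own_unique: "pco_spec D \<Longrightarrow> u \<in> own D i \<Longrightarrow> u \<in> own D j \<Longrightarrow> i = j"
  unfolding pco_spec_def by (meson disjoint_iff)

lemma trc_Nil_in_lang: "pco_spec D \<Longrightarrow> trc D [] \<in> lang D"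
  unfolding pco_spec_def by (elim conjE)

lemma common_closure:
  assumes "pco_spec D" "trc D v \<in> lang D" "set w \<subseteq> common D"
  shows "trc D (v @ w) \<in> lang D"
proof -
  have "\<forall>v\<in>lang D. \<forall>w\<in>traces D (common D). tcat D v w \<in> lang D"
    using assms(1) unfolding pco_spec_def by (elim conjE)
  moreover have "trc D w \<in> traces D (common D)" using assms(3) by (auto simp: traces_def)
  ultimately have "tcat D (trc D v) (trc D w) \<in> lang D" using assms(2) by simp
  then show ?thesis by (simp add: tcat_trc)
qed

lemma diamond_closure:
  assumes "pco_spec D" "trc D v \<in> lang D" "u \<in> own D i" "set z \<subseteq> alphabet D - own D i"
    and "trc D (v @ [u]) \<in> lang D" "trc D (v @ z) \<in> lang D"
  shows "trc D (v @ z @ [u]) \<in> lang D"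
proof -
  have "\<forall>v\<in>lang D. \<forall>i. \<forall>u\<in>own D i. \<forall>z\<in>traces D (alphabet D - own D i).
        tcat D v (trc D [u]) \<in> lang D \<longrightarrow> tcat D v z \<in> lang D \<longrightarrow>
        tcat D (tcat D v z) (trc D [u]) \<in> lang D"
    using assms(1) unfolding pco_spec_def by (elim conjE)
  moreover have "trc D z \<in> traces D (alphabet D - own D i)"
    using assms(4) by (auto simp: traces_def)
  moreover have "tcat D (trc D v) (trc D [u]) \<in> lang D" "tcat D (trc D v) (trc D z) \<in> lang D"
    using assms(5,6) by (simp_all only: tcat_trc)
  ultimately have "tcat D (tcat D (trc D v) (trc D z)) (trc D [u]) \<in> lang D"
    using assms(2,3) by blast
  then show ?thesis by (simp add: tcat_trc)
qed

text \<open>By disjointness, an exclusive set containing an authorized update can only be that of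
  its sender. With two different senders no exclusive set contains both updates.\<close>

lemma authorized_indep:
  assumes "pco_spec D" "authorized D x" "authorized D y" "fst x \<noteq> fst y"
  shows "(snd x, snd y) \<in> indep D"
proof -
  have sender: "k = fst z" if "authorized D z" "snd z \<in> own D k" for z k
    using that common_not_own[OF assms(1)] own_unique[OF assms(1)] unfolding authorized_def by blast
  have "snd x \<in> alphabet D" "snd y \<in> alphabet D"
    using assms(2,3) by (auto simp: authorized_def alphabet_def)
  moreover have "\<not> (snd x \<in> own D k \<and> snd y \<in> own D k)" for k
    using sender[OF assms(2)] sender[OF assms(3)] assms(4) by metis
  ultimately show ?thesis unfolding indep_def by blast
qed

lemma trc_move_front:
  assumes "pco_spec D" "authorized D y" "\<forall>x\<in>set xs. authorized D x \<and> fst x \<noteq> fst y"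
  shows "trc D (map snd (xs @ [y])) = trc D (map snd (y # xs))"
  using assms(3)
proof (induction xs)
  case (Cons x xs)
  have "trc D ([snd x] @ map snd (xs @ [y])) = trc D ([snd x] @ map snd (y # xs))"
    using Cons by (intro trc_cong_append) auto
  moreover have "(snd x, snd y) \<in> indep D"
    using authorized_indep[OF assms(1), of x y] Cons assms(2) by auto
  then have "(snd x # snd y # map snd xs, snd y # snd x # map snd xs) \<in> swap D"
    unfolding swap_def by (auto intro!: exI[of _ "[]"])
  then have "trc D (snd x # snd y # map snd xs) = trc D (snd y # snd x # map snd xs)"
    unfolding trc_eq_iff by blast
  ultimately show ?case by simp
qed simp

abbreviation from_sender :: "'p \<Rightarrow> ('p \<times> 'u) list \<Rightarrow> ('p \<times> 'u) list" where
  "from_sender j \<equiv> filter (\<lambda>x. fst x = j)"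

text \<open>The entries of \<open>ys\<close> are moved to the front of \<open>xs\<close> one after
  the other; \<open>zs\<close> is what remains.\<close>

lemma trc_split_prefix:
  assumes "pco_spec D" "\<forall>x\<in>set xs. authorized D x"
    and "\<And>j. prefix (from_sender j ys) (from_sender j xs)"
  shows "\<exists>zs. trc D (map snd xs) = trc D (map snd (ys @ zs)) \<and> set zs \<subseteq> set xs \<and>
    (\<forall>j. from_sender j xs = from_sender j ys @ from_sender j zs)"
  using assms(2,3)
proof (induction ys arbitrary: xs)
  case Nil
  then show ?case by auto
next
  case (Cons y ys)
  \<comment> \<open>\<open>y\<close> is the first entry of its sender in \<open>xs\<close>. The
    entries \<open>us\<close> in front of it come from other senders and therefore commute with
    it.\<close>
  have "prefix (y # from_sender (fst y) ys) (from_sender (fst y) xs)"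
    using Cons.prems(2)[of "fst y"] by simp
  then obtain r where r: "from_sender (fst y) xs = y # r" by (auto simp: prefix_def)
  then obtain us vs where uv: "xs = us @ y # vs" "\<forall>u\<in>set us. fst u \<noteq> fst y"
    unfolding filter_eq_Cons_iff by blast
  have pr: "prefix (from_sender j ys) (from_sender j (us @ vs))" for j
    using Cons.prems(2)[of j] uv by (cases "fst y = j") (auto simp: filter_empty_conv)
  have "\<forall>x\<in>set (us @ vs). authorized D x" using Cons.prems(1) uv by auto
  from Cons.IH[OF this pr] obtain zs where zs: "trc D (map snd (us @ vs)) = trc D (map snd (ys @ zs))"
    "set zs \<subseteq> set (us @ vs)" "\<And>j. from_sender j (us @ vs) = from_sender j ys @ from_sender j zs" by blast
  have "trc D (map snd (us @ [y]) @ map snd vs) = trc D (map snd (y # us) @ map snd vs)"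
    using Cons.prems(1) uv assms(1) by (intro trc_cong_append trc_move_front) auto
  also have "\<dots> = trc D ([snd y] @ map snd (us @ vs))" by simp
  also have "\<dots> = trc D ([snd y] @ map snd (ys @ zs))" using zs by (intro trc_cong_append) auto
  finally have t: "trc D (map snd xs) = trc D (map snd ((y # ys) @ zs))" using uv by simp
  have "from_sender j xs = from_sender j (y # ys) @ from_sender j zs" for j
    using zs(3)[of j] uv by (cases "fst y = j") (auto simp: filter_empty_conv)
  with t zs(2) uv(1) show ?case by (intro exI[of _ zs]) auto
qed

text \<open>The transfer of enabledness from a word \<open>ys\<close> to a sender-wise extension
  \<open>xs\<close>. It serves twice: to compare two processes, and to show that a pending update
  survives updates of other senders.\<close>

lemma lang_append_update:
  assumes spec: "pco_spec D" and auth: "\<forall>x\<in>set xs. authorized D x"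
    and pr: "\<And>i. prefix (from_sender i ys) (from_sender i xs)"
    and same: "from_sender j ys = from_sender j xs"
    and u: "authorized D (j, u)"
    and L: "trc D (map snd xs) \<in> lang D" "trc D (map snd ys) \<in> lang D"
      "trc D (map snd ys @ [u]) \<in> lang D"
  shows "trc D (map snd xs @ [u]) \<in> lang D"
proof (cases "u \<in> common D")
  case True
  then show ?thesis using common_closure[OF spec L(1)] by simp
next
  case False
  with u have uj: "u \<in> own D j" by (auto simp: authorized_def)
  from trc_split_prefix[OF spec auth pr] obtain zs where
    zs: "trc D (map snd xs) = trc D (map snd (ys @ zs))" "set zs \<subseteq> set xs"
      "\<forall>i. from_sender i xs = from_sender i ys @ from_sender i zs" by blast
  \<comment> \<open>By \<open>same\<close> the remainder \<open>zs\<close> has no entry sent by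
    \<open>j\<close>, and nobody else is authorized to issue an update in \<open>own D j\<close>.
    This is what diamond closure asks of \<open>zs\<close>.\<close>
  have "snd z \<in> alphabet D - own D j" if z: "z \<in> set zs" for z
  proof -
    have "from_sender j zs = []" using zs(3) same by auto
    with z have "fst z \<noteq> j" by (auto simp: filter_empty_conv)
    moreover have "authorized D z" using zs(2) z auth by auto
    ultimately show ?thesis 
      using common_not_own[OF spec, of "snd z"] own_unique[OF spec, of "snd z"]
      unfolding authorized_def alphabet_def by auto
  qed
  then have "trc D (map snd ys @ map snd zs @ [u]) \<in> lang D"
    using L zs(1) by (intro diamond_closure[OF spec L(2) uj]) auto
  then show ?thesis using trc_cong_append[OF zs(1), of "[u]" "[u]"] by simp
qed

section \<open>Executions of Algorithm G\<close>

lemma prefix_map_upt: "m \<le> n \<Longrightarrow> prefix (map f [1..<Suc m]) (map f [1..<Suc n])"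
  by (induction n rule: dec_induct) (auto intro: prefix_order.trans)

locale algorithm_run =
  fixes D :: "('p, 'u, 'v) pco"
    and out :: "'u \<Rightarrow> 'u trace \<Rightarrow> 'v"
    and Byz :: "'p set"
    and \<sigma> :: "nat \<Rightarrow> 'p \<Rightarrow> ('p, 'u, 'v, 'm) lstate"
    and \<alpha> :: "nat \<Rightarrow> ('p, 'u, 'v, 'm) event"
  assumes spec: "pco_spec D"
    and exec: "execution D out Byz \<sigma> \<alpha>"
begin

section \<open>Consequences of the execution assumptions\<close>

lemma initial: "p \<notin> Byz \<Longrightarrow> \<sigma> 0 p = init"
  using exec by (simp add: execution_def)

lemma transition [consumes 1, case_names act idle]:
  assumes "p \<notin> Byz"
  obtains (act) "actor (\<alpha> k) = Some p" "lstep D out p (\<sigma> k p) (\<alpha> k) (\<sigma> (Suc k) p)"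
  | (idle) "actor (\<alpha> k) \<noteq> Some p" "\<sigma> (Suc k) p = \<sigma> k p"
proof -
  have "gstep D out Byz (\<sigma> k) (\<alpha> k) (\<sigma> (Suc k))" using exec by (simp add: execution_def)
  then show thesis using assms act idle unfolding gstep_def by metis
qed

lemma actor_lstep: "p \<notin> Byz \<Longrightarrow> actor (\<alpha> k) = Some p \<Longrightarrow> lstep D out p (\<sigma> k p) (\<alpha> k) (\<sigma> (Suc k) p)"
  by (cases rule: transition[where k = k]) auto

lemma validity:
  "p \<notin> Byz \<Longrightarrow> j \<notin> Byz \<Longrightarrow> \<alpha> k = RDeliver p j n m \<Longrightarrow> \<exists>l<k. \<alpha> l = RBroadcast j n m"
  using exec unfolding execution_def br_broadcast_def rb_validity_def by blast

lemma integrity: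
  "p \<notin> Byz \<Longrightarrow> \<alpha> k = RDeliver p j n m \<Longrightarrow> \<alpha> l = RDeliver p j n m' \<Longrightarrow> k = l"
  using exec unfolding execution_def br_broadcast_def rb_integrity_def by blast

lemma termination_1: "p \<notin> Byz \<Longrightarrow> \<alpha> k = RBroadcast p n m \<Longrightarrow> \<exists>l. \<alpha> l = RDeliver p p n m"
  using exec unfolding execution_def br_broadcast_def rb_termination_1_def by blast

lemma termination_2:
  "p \<notin> Byz \<Longrightarrow> q \<notin> Byz \<Longrightarrow> \<alpha> k = RDeliver p j n m \<Longrightarrow> \<exists>l. \<alpha> l = RDeliver q j n m"
  using exec unfolding execution_def br_broadcast_def rb_termination_2_def by blast

lemma operation_progress:
  assumes "p \<notin> Byz" "\<And>i. i \<ge> k \<Longrightarrow> \<exists>e s'. op_event p e \<and> lstep D out p (\<sigma> i p) e s'"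
  shows "\<exists>i\<ge>k. op_event p (\<alpha> i)"
  using exec assms unfolding execution_def progress_def by blast

lemma handler_progress:
  assumes "p \<notin> Byz" "\<And>i. i \<ge> k \<Longrightarrow> \<exists>s'. lstep D out p (\<sigma> i p) (Process p j n u) s'"
  shows "\<exists>i\<ge>k. \<alpha> i = Process p j n u"
  using exec assms unfolding execution_def progress_def by blast

lemma op_event_actor: "op_event p e \<Longrightarrow> actor e = Some p"
  by (cases e) auto

subsection \<open>Processed messages\<close>

text \<open>Entries stay at their event index, so \<open>pre (log p) k\<close> is what
  \<open>p\<close> has processed in configuration \<open>\<sigma> k\<close>.\<close>

definition log :: "'p \<Rightarrow> nat \<Rightarrow> ('p \<times> 'u) option" where
  "log p k = (case \<alpha> k of Process q j n u \<Rightarrow> if q = p then Some (j, u) else None | _ \<Rightarrow> None)"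

text \<open>The choice is unique by \<open>msg_eq\<close> as soon as some correct process r-delivers
  an update with this sender and number; elsewhere the value is arbitrary.\<close>

definition msg :: "'p \<Rightarrow> nat \<Rightarrow> 'u" where
  "msg j n = (SOME u. \<exists>p k. p \<notin> Byz \<and> \<alpha> k = RDeliver p j n (Apply u))"

text \<open>Termination-2 brings the content delivered at any correct process to \<open>p\<close> as
  well, and Integrity admits only one content there.\<close>

lemma msg_eq:
  assumes "p \<notin> Byz" "\<alpha> k = RDeliver p j n (Apply u)"
  shows "msg j n = u"
  unfolding msg_def
proof (rule some_equality)
  show "\<exists>p k. p \<notin> Byz \<and> \<alpha> k = RDeliver p j n (Apply u)" using assms by blast
  fix u' assume "\<exists>p k. p \<notin> Byz \<and> \<alpha> k = RDeliver p j n (Apply u')"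
  then obtain l where l: "\<alpha> l = RDeliver p j n (Apply u')" using termination_2 assms(1) by blast
  then have "k = l" using integrity[OF assms] by blast
  with l assms(2) show "u' = u" by simp
qed

lemma inbox_delivered:
  assumes "p \<notin> Byz" "(j, n, m) \<in> inbox (\<sigma> k p)"
  shows "\<exists>i<k. \<alpha> i = RDeliver p j n m"
  using assms(2)
proof (induction k)
  case 0
  then show ?case using initial[OF assms(1)] by (simp add: init_def)
next
  case (Suc k)
  show ?case
  using assms(1)
  proof (cases rule: transition[where k = k])
    case act
    from act(2) Suc show ?thesis by cases (auto simp: less_Suc_eq)
  next
    case idle
    with Suc show ?thesis by (auto simp: less_Suc_eq)
  qed
qed

lemma process_step:
  assumes "p \<notin> Byz" "\<alpha> k = Process p j n u"
  shows "(j, n, Apply u) \<in> inbox (\<sigma> k p)" "authorized D (j, u)" "n = Suc (del (\<sigma> k p) j)"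
    "trc D (seqv (\<sigma> k p) @ [u]) \<in> lang D"
    "\<sigma> (Suc k) p = (\<sigma> k p)\<lparr>seqv := seqv (\<sigma> k p) @ [u], del := (del (\<sigma> k p))(j := n),
       inbox := inbox (\<sigma> k p) - {(j, n, Apply u)},
       base := (if j = p then seqv (\<sigma> k p) else base (\<sigma> k p))\<rparr>"
proof -
  have "lstep D out p (\<sigma> k p) (Process p j n u) (\<sigma> (Suc k) p)"
    using actor_lstep[OF assms(1), of k] assms(2) by simp
  then show "(j, n, Apply u) \<in> inbox (\<sigma> k p)" "authorized D (j, u)" "n = Suc (del (\<sigma> k p) j)"
    "trc D (seqv (\<sigma> k p) @ [u]) \<in> lang D"
    "\<sigma> (Suc k) p = (\<sigma> k p)\<lparr>seqv := seqv (\<sigma> k p) @ [u], del := (del (\<sigma> k p))(j := n),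
       inbox := inbox (\<sigma> k p) - {(j, n, Apply u)},
       base := (if j = p then seqv (\<sigma> k p) else base (\<sigma> k p))\<rparr>"
    by (cases; simp add: authorized_def)+
qed

lemma no_process_step:
  assumes "p \<notin> Byz" "\<And>j n u. \<alpha> k \<noteq> Process p j n u"
  shows "seqv (\<sigma> (Suc k) p) = seqv (\<sigma> k p)" "del (\<sigma> (Suc k) p) = del (\<sigma> k p)"
    "base (\<sigma> (Suc k) p) = base (\<sigma> k p)" "inbox (\<sigma> k p) \<subseteq> inbox (\<sigma> (Suc k) p)" "log p k = None"
proof -
  have "seqv (\<sigma> (Suc k) p) = seqv (\<sigma> k p) \<and> del (\<sigma> (Suc k) p) = del (\<sigma> k p) \<and>
    base (\<sigma> (Suc k) p) = base (\<sigma> k p) \<and> inbox (\<sigma> k p) \<subseteq> inbox (\<sigma> (Suc k) p)"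
  using assms(1)
  proof (cases rule: transition[where k = k])
    case act
    from act(2) show ?thesis by cases (use assms(2) in auto)
  qed auto
  then show "seqv (\<sigma> (Suc k) p) = seqv (\<sigma> k p)" "del (\<sigma> (Suc k) p) = del (\<sigma> k p)"
    "base (\<sigma> (Suc k) p) = base (\<sigma> k p)" "inbox (\<sigma> k p) \<subseteq> inbox (\<sigma> (Suc k) p)" by blast+
  show "log p k = None" using assms(2) by (auto simp: log_def split: event.splits)
qed

lemma process_delivered:
  assumes "p \<notin> Byz" "\<alpha> k = Process p j n u"
  shows "\<exists>i<k. \<alpha> i = RDeliver p j n (Apply u)"
  using inbox_delivered[OF assms(1) process_step(1)[OF assms]] .

lemma process_msg: "p \<notin> Byz \<Longrightarrow> \<alpha> k = Process p j n u \<Longrightarrow> msg j n = u"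
  using process_delivered msg_eq by blast

text \<open>A handler waits for the number \<open>del j + 1\<close>, so messages of \<open>j\<close>
  are processed without gaps and the counter alone determines the part of the log sent by
  \<open>j\<close>. Comparing logs of correct processes thus reduces to comparing counters.\<close>

lemma log_state:
  assumes "p \<notin> Byz"
  shows "seqv (\<sigma> k p) = map snd (pre (log p) k) \<and>
    (\<forall>j. from_sender j (pre (log p) k) = map (\<lambda>n. (j, msg j n)) [1..<Suc (del (\<sigma> k p) j)]) \<and>
    (\<forall>x\<in>set (pre (log p) k). authorized D x) \<and> trc D (seqv (\<sigma> k p)) \<in> lang D"
proof (induction k)
  case 0
  then show ?case using initial[OF assms] trc_Nil_in_lang[OF spec] by (simp add: init_def)
next
  case (Suc k)
  show ?case
  proof (cases "\<exists>j n u. \<alpha> k = Process p j n u")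
    case True
    then obtain j n u where e: "\<alpha> k = Process p j n u" by blast
    note P = process_step[OF assms e]
    have "pre (log p) (Suc k) = pre (log p) k @ [(j, u)]" by (simp add: pre_Suc log_def e)
    with Suc P process_msg[OF assms e] show ?thesis by auto
  next
    case False
    with no_process_step[OF assms, of k] Suc show ?thesis by (auto simp: pre_Suc)
  qed
qed

lemma seqv_log: "p \<notin> Byz \<Longrightarrow> seqv (\<sigma> k p) = map snd (pre (log p) k)"
  and from_sender_log: "p \<notin> Byz \<Longrightarrow>
    from_sender j (pre (log p) k) = map (\<lambda>n. (j, msg j n)) [1..<Suc (del (\<sigma> k p) j)]"
  and log_authorized: "p \<notin> Byz \<Longrightarrow> \<forall>x\<in>set (pre (log p) k). authorized D x"
  and seqv_lang: "p \<notin> Byz \<Longrightarrow> trc D (seqv (\<sigma> k p)) \<in> lang D"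
  using log_state by blast+

section \<open>Every correct process catches up with every other\<close>

lemma del_mono:
  assumes "p \<notin> Byz" "k \<le> l"
  shows "del (\<sigma> k p) j \<le> del (\<sigma> l p) j"
  using assms(2)
proof (induction l rule: dec_induct)
  case (step l)
  have "del (\<sigma> l p) j \<le> del (\<sigma> (Suc l) p) j"
  proof (cases "\<exists>i n u. \<alpha> l = Process p i n u")
    case True
    then obtain i n u where e: "\<alpha> l = Process p i n u" by blast
    show ?thesis using process_step[OF assms(1) e] by simp
  next
    case False
    with no_process_step[OF assms(1), of l] show ?thesis by auto
  qed
  with step show ?case by simp
qed simp

text \<open>A message leaves the inbox only by being processed, which sets the counter to
  \<open>n\<close>, and counters never decrease.\<close>

lemma delivered_pending:
  assumes "p \<notin> Byz" "\<alpha> i = RDeliver p j n (Apply u)" "i < k"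
  shows "(j, n, Apply u) \<in> inbox (\<sigma> k p) \<or> n \<le> del (\<sigma> k p) j"
  using assms(3)
proof (induction k)
  case (Suc k)
  show ?case
  proof (cases "i = k")
    case True
    have "lstep D out p (\<sigma> k p) (\<alpha> k) (\<sigma> (Suc k) p)"
      using actor_lstep[OF assms(1), of k] assms(2) True by simp
    then show ?thesis by cases (use assms(2) True in auto)
  next
    case False
    with Suc have IH: "(j, n, Apply u) \<in> inbox (\<sigma> k p) \<or> n \<le> del (\<sigma> k p) j" by simp
    show ?thesis
    proof (cases "\<exists>j n u. \<alpha> k = Process p j n u")
      case True
      then obtain j' n' u' where e: "\<alpha> k = Process p j' n' u'" by blast
      show ?thesis using process_step[OF assms(1) e] IH by auto
    next
      case False
      with no_process_step[OF assms(1), of k] IH show ?thesis by auto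
    qed
  qed
qed simp

text \<open>If the counter stayed below \<open>n\<close> forever, the handler would be enabled from
  some point on; weak fairness would let it run, which sets the counter to \<open>n\<close>.\<close>

lemma eventually_processed:
  assumes p: "p \<notin> Byz" and d: "\<alpha> i = RDeliver p j n (Apply u)" and a: "authorized D (j, u)"
    and en: "\<And>k. k \<ge> k0 \<Longrightarrow> del (\<sigma> k p) j < n \<Longrightarrow>
      n = Suc (del (\<sigma> k p) j) \<and> trc D (seqv (\<sigma> k p) @ [u]) \<in> lang D"
  shows "\<exists>k. n \<le> del (\<sigma> k p) j"
proof (rule ccontr)
  assume "\<not> ?thesis"
  then have lt: "del (\<sigma> k p) j < n" for k by (simp add: not_le)
  have "\<exists>s'. lstep D out p (\<sigma> k p) (Process p j n u) s'" if "k \<ge> max k0 (Suc i)" for k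
  proof -
    have "(j, n, Apply u) \<in> inbox (\<sigma> k p)"
      using delivered_pending[OF p d, of k] that lt[of k] by simp
    then show ?thesis using en[of k] lt[of k] that a lstep.process[of j n u "\<sigma> k p" D out p]
      by (auto simp: authorized_def)
  qed
  from handler_progress[OF p this] obtain k where e: "\<alpha> k = Process p j n u" by blast
  show False using process_step[OF p e] lt[of "Suc k"] by simp
qed

text \<open>Induction over the events of \<open>p\<close>: once \<open>q\<close> covers everything
  before an update processed by \<open>p\<close>, that update is enabled at \<open>q\<close> until
  \<open>q\<close> has processed it.\<close>

lemma catch_up:
  assumes p: "p \<notin> Byz" and q: "q \<notin> Byz"
  shows "\<exists>l. \<forall>j. del (\<sigma> k p) j \<le> del (\<sigma> l q) j"
proof (induction k)
  case 0
  then show ?case using initial[OF p] by (simp add: init_def)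
next
  case (Suc k)
  then obtain l where l: "\<And>j. del (\<sigma> k p) j \<le> del (\<sigma> l q) j" by blast
  show ?case
  proof (cases "\<exists>j n u. \<alpha> k = Process p j n u")
    case False
    with no_process_step[OF p, of k] l show ?thesis by auto
  next
    case True
    then obtain j n u where e: "\<alpha> k = Process p j n u" by blast
    note P = process_step[OF p e]
    obtain i where i: "\<alpha> i = RDeliver q j n (Apply u)"
      using process_delivered[OF p e] termination_2[OF p q] by blast
    have "\<exists>l'. n \<le> del (\<sigma> l' q) j"
    proof (rule eventually_processed[OF q i P(2), of l])
      fix k' assume k': "k' \<ge> l" "del (\<sigma> k' q) j < n"
      have le: "del (\<sigma> k p) i \<le> del (\<sigma> k' q) i" for i
        using l[of i] del_mono[OF q k'(1), of i] by simp
      \<comment> \<open>The counter of \<open>q\<close> is below \<open>n\<close> but at least that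
        of \<open>p\<close>, which is \<open>n - 1\<close>. So the logs of \<open>p\<close> and
        \<open>q\<close> agree on sender \<open>j\<close>.\<close>
      then have n: "n = Suc (del (\<sigma> k' q) j)" using k'(2) P(3) le[of j] by linarith
      moreover have "trc D (map snd (pre (log q) k') @ [u]) \<in> lang D"
      proof (rule lang_append_update[OF spec log_authorized[OF q] _ _ P(2)])
        show "prefix (from_sender i (pre (log p) k)) (from_sender i (pre (log q) k'))" for i
          unfolding from_sender_log[OF p] from_sender_log[OF q] by (rule prefix_map_upt[OF le])
        show "from_sender j (pre (log p) k) = from_sender j (pre (log q) k')"
          unfolding from_sender_log[OF p] from_sender_log[OF q] using n P(3) by simp
      qed (use seqv_lang[OF p, of k] seqv_lang[OF q, of k'] P(4) in \<open>simp_all add: seqv_log p q\<close>)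
      ultimately show "n = Suc (del (\<sigma> k' q) j) \<and> trc D (seqv (\<sigma> k' q) @ [u]) \<in> lang D"
        by (simp add: seqv_log[OF q])
    qed
    then obtain l' where l': "n \<le> del (\<sigma> l' q) j" by blast
    have "del (\<sigma> (Suc k) p) i \<le> del (\<sigma> (max l l') q) i" for i
      using l[of i] l' P(5) del_mono[OF q, of l "max l l'" i] del_mono[OF q, of l' "max l l'" i]
      by (cases "i = j") auto
    then show ?thesis by blast
  qed
qed

subsection \<open>Pending operations\<close>

text \<open>A joint invariant: a pending update is either processed or carries the next number and
  is still enabled. The last conjunct identifies the broadcast with the current number as that of
  the pending update.\<close>

lemma ctl_state:
  assumes p: "p \<notin> Byz"
  shows "(\<forall>op. ctl (\<sigma> k p) = Invoked op \<longrightarrow> op \<in> Upd ` alphabet D \<union> Qry ` queries D) \<and>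
    ((\<nexists>u. ctl (\<sigma> k p) = Waiting u) \<longrightarrow> del (\<sigma> k p) p = sn (\<sigma> k p)) \<and>
    (\<forall>u. ctl (\<sigma> k p) = Waiting u \<longrightarrow> authorized D (p, u) \<and>
      (\<exists>i. \<alpha> i = RBroadcast p (sn (\<sigma> k p)) (Apply u)) \<and>
      (del (\<sigma> k p) p = sn (\<sigma> k p) \<or>
       Suc (del (\<sigma> k p) p) = sn (\<sigma> k p) \<and> trc D (seqv (\<sigma> k p) @ [u]) \<in> lang D)) \<and>
    (\<forall>i<k. \<forall>n m. \<alpha> i = RBroadcast p n m \<longrightarrow> n \<le> sn (\<sigma> k p) \<and>
      (\<forall>u. n = sn (\<sigma> k p) \<longrightarrow> ctl (\<sigma> k p) = Waiting u \<longrightarrow> m = Apply u))"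
proof (induction k)
  case 0
  then show ?case using initial[OF p] by (simp add: init_def)
next
  case (Suc k)
  show ?case
  using p
  proof (cases rule: transition[where k = k])
    case idle
    then have "\<alpha> k \<noteq> RBroadcast p n m" for n m by auto
    with Suc idle show ?thesis by (auto simp: less_Suc_eq)
  next
    case act
    from act(2) show ?thesis
    proof cases
      case (process j n u)
      note P = process_step[OF p \<open>\<alpha> k = Process p j n u\<close>]
      have sn: "sn (\<sigma> (Suc k) p) = sn (\<sigma> k p)" and ctl: "ctl (\<sigma> (Suc k) p) = ctl (\<sigma> k p)"
        using P(5) by simp_all
      have other: "\<forall>op. ctl (\<sigma> k p) = Invoked op \<longrightarrow> op \<in> Upd ` alphabet D \<union> Qry ` queries D"
        "\<forall>u. ctl (\<sigma> k p) = Waiting u \<longrightarrow> authorized D (p, u) \<and>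
          (\<exists>i. \<alpha> i = RBroadcast p (sn (\<sigma> k p)) (Apply u))"
        using Suc by blast+
      have bc: "\<forall>i<Suc k. \<forall>n m. \<alpha> i = RBroadcast p n m \<longrightarrow> n \<le> sn (\<sigma> k p) \<and>
        (\<forall>u. n = sn (\<sigma> k p) \<longrightarrow> ctl (\<sigma> k p) = Waiting u \<longrightarrow> m = Apply u)"
        using Suc process by (simp add: less_Suc_eq)
      show ?thesis
      proof (cases "j = p")
        case True
        \<comment> \<open>Validity traces the message back to an earlier broadcast by
          \<open>p\<close> itself, which bounds \<open>n\<close> by \<open>sn\<close>. As
          \<open>n\<close> also exceeds the counter, the counter reaches \<open>sn\<close>
          now.\<close>
        obtain i where i: "i < k" "\<alpha> i = RBroadcast p n (Apply u)"
          using process_delivered[OF p \<open>\<alpha> k = Process p j n u\<close>] validity[OF p p] True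
          by (metis order_less_trans)
        then have "n \<le> sn (\<sigma> k p)" using Suc by blast
        moreover have "n = Suc (del (\<sigma> k p) p)" using P(3) True by simp
        moreover have "Suc (del (\<sigma> k p) p) \<le> sn (\<sigma> k p) \<Longrightarrow> Suc (del (\<sigma> k p) p) = sn (\<sigma> k p)"
          using Suc by (metis Suc_n_not_le_n)
        ultimately have "del (\<sigma> (Suc k) p) p = sn (\<sigma> k p)" using P(5) True by simp
        with other bc show ?thesis unfolding sn ctl by simp
      next
        case False
        have del: "del (\<sigma> (Suc k) p) p = del (\<sigma> k p) p" using P(5) False by simp
        \<comment> \<open>The new log entry comes from \<open>j\<close>, different from
          \<open>p\<close>, so the part of the log sent by \<open>p\<close> is unchanged and an
          update of \<open>p\<close> stays enabled.\<close>
        have "trc D (seqv (\<sigma> (Suc k) p) @ [w]) \<in> lang D"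
          if w: "authorized D (p, w)" "trc D (seqv (\<sigma> k p) @ [w]) \<in> lang D" for w
        proof -
          have "trc D (map snd (pre (log p) k @ [(j, u)]) @ [w]) \<in> lang D"
            by (rule lang_append_update[OF spec _ _ _ w(1), where ys = "pre (log p) k"])
              (use log_authorized[OF p] P(2,4) seqv_lang[OF p, of k] w(2) False
               in \<open>simp_all add: seqv_log p\<close>)
          then show ?thesis using P(5) by (simp add: seqv_log p)
        qed
        then have "\<forall>u. ctl (\<sigma> k p) = Waiting u \<longrightarrow> del (\<sigma> k p) p = sn (\<sigma> k p) \<or>
            Suc (del (\<sigma> k p) p) = sn (\<sigma> k p) \<and> trc D (seqv (\<sigma> (Suc k) p) @ [u]) \<in> lang D"
          using Suc by blast
        with other bc Suc show ?thesis unfolding sn ctl del by simp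
      qed
    qed (use Suc in \<open>auto simp: less_Suc_eq authorized_def\<close>)
  qed
qed

lemma invoked_op: "p \<notin> Byz \<Longrightarrow> ctl (\<sigma> k p) = Invoked op \<Longrightarrow> op \<in> Upd ` alphabet D \<union> Qry ` queries D"
  and not_waiting_sn: "p \<notin> Byz \<Longrightarrow> \<nexists>u. ctl (\<sigma> k p) = Waiting u \<Longrightarrow> del (\<sigma> k p) p = sn (\<sigma> k p)"
  and waiting: "p \<notin> Byz \<Longrightarrow> ctl (\<sigma> k p) = Waiting u \<Longrightarrow> authorized D (p, u) \<and>
      (\<exists>i. \<alpha> i = RBroadcast p (sn (\<sigma> k p)) (Apply u)) \<and>
      (del (\<sigma> k p) p = sn (\<sigma> k p) \<or>
       Suc (del (\<sigma> k p) p) = sn (\<sigma> k p) \<and> trc D (seqv (\<sigma> k p) @ [u]) \<in> lang D)"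
  and broadcast_sn: "p \<notin> Byz \<Longrightarrow> i < k \<Longrightarrow> \<alpha> i = RBroadcast p n m \<Longrightarrow> n \<le> sn (\<sigma> k p) \<and>
      (\<forall>u. n = sn (\<sigma> k p) \<longrightarrow> ctl (\<sigma> k p) = Waiting u \<longrightarrow> m = Apply u)"
  using ctl_state[of p k] by blast+

text \<open>The number is \<open>del + 1\<close> and at most \<open>sn\<close>. Without a pending
  broadcast the counter equals \<open>sn\<close>, so \<open>p\<close> must be waiting; then the
  number is \<open>sn\<close>, whose broadcast carries the pending update.\<close>

lemma own_process:
  assumes p: "p \<notin> Byz" and e: "\<alpha> k = Process p p n u"
  shows "ctl (\<sigma> k p) = Waiting u \<and> n = sn (\<sigma> k p)"
proof -
  obtain i where i: "i < k" "\<alpha> i = RBroadcast p n (Apply u)"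
    using process_delivered[OF p e] validity[OF p p] by (metis order_less_trans)
  note b = broadcast_sn[OF p i]
  have n: "n = Suc (del (\<sigma> k p) p)" using process_step(3)[OF p e] .
  then obtain w where w: "ctl (\<sigma> k p) = Waiting w" using not_waiting_sn[OF p, of k] b by force
  with waiting[OF p w] n b have "n = sn (\<sigma> k p)" by auto
  with b w show ?thesis by auto
qed

text \<open>Termination-1 delivers the own broadcast, the invariant keeps it enabled until it is
  processed, and from then on fairness forces the return.\<close>

lemma waiting_ends:
  assumes p: "p \<notin> Byz" and w: "ctl (\<sigma> k p) = Waiting u"
  shows "\<exists>l\<ge>k. \<exists>v. \<alpha> l = Return p (Upd u) v"
proof (rule ccontr)
  assume no: "\<not> ?thesis"
  \<comment> \<open>Only a return leaves the waiting state, so without one both the control state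
    and the sequence number are frozen.\<close>
  have st: "ctl (\<sigma> l p) = Waiting u \<and> sn (\<sigma> l p) = sn (\<sigma> k p)" if "l \<ge> k" for l
    using that
  proof (induction l rule: dec_induct)
    case (step l)
    show ?case
    using p
    proof (cases rule: transition[where k = l])
      case act
      from act(2) show ?thesis by cases (use step no in auto)
    qed (use step in auto)
  qed (use w in simp)
  let ?n = "sn (\<sigma> k p)"
  obtain i where "\<alpha> i = RBroadcast p ?n (Apply u)" using waiting[OF p w] by blast
  then obtain i where i: "\<alpha> i = RDeliver p p ?n (Apply u)" using termination_1[OF p] by blast
  have "\<exists>l. ?n \<le> del (\<sigma> l p) p"
  proof (rule eventually_processed[OF p i, of k])
    show "authorized D (p, u)" using waiting[OF p w] by blast
    fix l assume "l \<ge> k" "del (\<sigma> l p) p < ?n"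
    then show "?n = Suc (del (\<sigma> l p) p) \<and> trc D (seqv (\<sigma> l p) @ [u]) \<in> lang D"
      using st[of l] waiting[OF p, of l u] by auto
  qed
  then obtain l where l: "?n \<le> del (\<sigma> l p) p" by blast
  have "\<exists>e s'. op_event p e \<and> lstep D out p (\<sigma> m p) e s'" if "m \<ge> max k l" for m
  proof -
    have "?n \<le> del (\<sigma> m p) p" using l del_mono[OF p, of l m p] that by simp
    then have "del (\<sigma> m p) p = sn (\<sigma> m p)" using st[of m] waiting[OF p, of m u] that by auto
    then show ?thesis using st[of m] that update_return[of "\<sigma> m p" u p D out]
      by (metis max.bounded_iff op_event.simps(1))
  qed
  from operation_progress[OF p this] obtain m where m: "m \<ge> max k l" "op_event p (\<alpha> m)" by blast
  from actor_lstep[OF p op_event_actor[OF m(2)]] show False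
    by cases (use m st[of m] no in auto)
qed

lemma operations_terminate:
  assumes p: "p \<notin> Byz"
  shows "ops_terminate p \<alpha>"
  unfolding ops_terminate_def
proof (intro allI impI, rule ccontr)
  fix k op
  assume e: "\<alpha> k = Invoke p op" and no: "\<not> (\<exists>l>k. (\<exists>v. \<alpha> l = Return p op v) \<or> \<alpha> l = Abort p op)"
  have start: "ctl (\<sigma> (Suc k) p) = Invoked op"
  proof -
    have "lstep D out p (\<sigma> k p) (\<alpha> k) (\<sigma> (Suc k) p)" using actor_lstep[OF p, of k] e by simp
    then show ?thesis by cases (use e in auto)
  qed
  \<comment> \<open>An update that gets as far as its broadcast returns by
    \<open>waiting_ends\<close>, so an unanswered operation never reaches the waiting state.\<close>
  have nw: "ctl (\<sigma> l p) \<noteq> Waiting u" if "l > k" "op = Upd u" for l u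
    using waiting_ends[OF p, of l u] no that by (meson order_less_le_trans)
  have st: "ctl (\<sigma> l p) = Invoked op" if "l \<ge> Suc k" for l
    using that
  proof (induction l rule: dec_induct)
    case (step l)
    show ?case
    using p
    proof (cases rule: transition[where k = l])
      case act
      from act(2) show ?thesis by cases (use step no nw[of "Suc l"] in auto)
    qed (use step in auto)
  qed (rule start)
  \<comment> \<open>In the invoked state a step is always enabled: a query returns, an update is
    broadcast or aborted according to the test.\<close>
  have "\<exists>e s'. op_event p e \<and> lstep D out p (\<sigma> l p) e s'" if "l \<ge> Suc k" for l
  proof (cases op)
    case (Qry q)
    then show ?thesis using query_return[of "\<sigma> l p" q D out p] st[OF that]
      by (metis op_event.simps(1))
  next
    case (Upd u)
    then show ?thesis
      using update_broadcast[of "\<sigma> l p" u D p out] update_abort[of "\<sigma> l p" u D p out] st[OF that]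
      by (metis op_event.simps(2,3))
  qed
  from operation_progress[OF p this] obtain l where l: "l \<ge> Suc k" "op_event p (\<alpha> l)" by blast
  from actor_lstep[OF p op_event_actor[OF l(2)]] show False
    by cases (use l st[of l] no nw[of "Suc l"] in auto)
qed

lemma provides:
  assumes "p \<notin> Byz"
  shows "provides_ops D out p (\<sigma> k p)"
  unfolding provides_ops_def
proof (intro conjI impI ballI)
  fix op assume i: "ctl (\<sigma> k p) = Idle" and "op \<in> ops_of D p"
  then have "op \<in> Upd ` alphabet D \<union> Qry ` queries D" by (auto simp: ops_of_def alphabet_def)
  with i show "\<exists>s'. lstep D out p (\<sigma> k p) (Invoke p op) s'"
    using lstep.invoke[of "\<sigma> k p" op D out p] by metis
next
  fix u assume a: "u \<in> common D \<union> own D p" "ctl (\<sigma> k p) = Invoked (Upd u)"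
    "trc D (seqv (\<sigma> k p) @ [u]) \<in> lang D"
  then show "\<exists>n s'. lstep D out p (\<sigma> k p) (RBroadcast p n (Apply u)) s'"
    using lstep.update_broadcast[of "\<sigma> k p" u D p out] by metis
  show "\<nexists>s'. lstep D out p (\<sigma> k p) (Abort p (Upd u)) s'"
    using a by (auto elim: lstep.cases)
qed

subsection \<open>Serializations\<close>

definition returns :: "'p \<Rightarrow> nat \<Rightarrow> ('p, 'u, 'v) invocation option" where
  "returns p k = (case \<alpha> k of
     Return q op v \<Rightarrow> if q = p then Some (op, Some v, p) else None | _ \<Rightarrow> None)"

lemma history_returns: "history_of \<alpha> p = compress (returns p)"
  by (simp add: history_of_def returns_def[abs_def])

text \<open>An own update of \<open>p\<close> is placed at the moment when \<open>p\<close> processes it rather than when it returns: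
  in between, \<open>p\<close> may process further updates, which its return value does not take into account.\<close>

definition view :: "'p \<Rightarrow> nat \<Rightarrow> ('p, 'u, 'v) invocation option" where
  "view p k = (case \<alpha> k of
     Process q j n u \<Rightarrow> if q = p
       then Some (Upd u, if j = p then Some (out u (trc D (seqv (\<sigma> k p)))) else None, j) else None
   | Return q (Qry f) v \<Rightarrow> if q = p then Some (Qry f, Some v, p) else None
   | _ \<Rightarrow> None)"

lemma return_ops:
  assumes p: "p \<notin> Byz" and e: "\<alpha> k = Return p op v"
  shows "op \<in> ops_of D p"
proof -
  have "lstep D out p (\<sigma> k p) (\<alpha> k) (\<sigma> (Suc k) p)" using actor_lstep[OF p, of k] e by simp
  then show ?thesis
  proof cases
    case (query_return q)
    then show ?thesis using invoked_op[OF p, of k "Qry q"] e by (auto simp: ops_of_def)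
  next
    case (update_return u)
    then show ?thesis using waiting[OF p, of k u] e by (auto simp: ops_of_def authorized_def)
  qed (use e in auto)
qed

lemma local_history_returns: "p \<notin> Byz \<Longrightarrow> local_history D p (history_of \<alpha> p)"
  unfolding local_history_def history_returns
  by (auto simp: is_seq_compress compress_eq_Some_iff returns_def return_ops
      split: event.split_asm if_split_asm)

text \<open>The view runs ahead of the returns by at most one entry, the own update that is
  processed but has not returned. \<open>base\<close> preserves the state on which its value
  depends.\<close>

lemma pre_part_view_returns:
  assumes p: "p \<notin> Byz"
  shows "pre (part p (view p)) k = pre (returns p) k @
    (case ctl (\<sigma> k p) of Waiting u \<Rightarrow>
       if del (\<sigma> k p) p = sn (\<sigma> k p) then [(Upd u, Some (out u (trc D (base (\<sigma> k p)))), p)] else []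
     | _ \<Rightarrow> [])"
proof (induction k)
  case 0
  then show ?case using initial[OF p] by (simp add: init_def)
next
  case (Suc k)
  show ?case
  using p
  proof (cases rule: transition[where k = k])
    case idle
    then have "view p k = None" "returns p k = None"
      by (auto simp: view_def returns_def split: event.splits operation.splits)
    with Suc idle show ?thesis by (simp add: pre_Suc part_def split: control.split)
  next
    case act
    from act(2) show ?thesis
    proof cases
      case (process j n u)
      note e = \<open>\<alpha> k = Process p j n u\<close>
      have r: "returns p k = None" by (simp add: returns_def e)
      show ?thesis
      proof (cases "j = p")
        case True
        then show ?thesis using Suc own_process[OF p, of k n u] process_step[OF p e] e r
          by (simp add: pre_Suc view_def part_def)
      next
        case False
        then have "part p (view p) k = None" by (simp add: view_def part_def e)
        with Suc r process_step[OF p e] False show ?thesis by (simp add: pre_Suc split: control.splits)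
      qed
    \<comment> \<open>At a broadcast the counter equals the old \<open>sn\<close>, hence differs
      from the new one, and no surplus entry appears.\<close>
    qed (use Suc not_waiting_sn[OF p, of k] in
        \<open>auto simp: pre_Suc part_def view_def returns_def split: control.splits\<close>)
  qed
qed

text \<open>Every wait ends, and in a configuration without waiting the two prefixes
  coincide.\<close>

lemma compress_returns:
  assumes p: "p \<notin> Byz"
  shows "compress (returns p) = compress (part p (view p))"
proof (rule compress_cong)
  show "\<exists>l. prefix (pre (returns p) k) (pre (part p (view p)) l)" for k
    unfolding pre_part_view_returns[OF p] by (meson prefixI)
  fix k
  have "\<exists>l\<ge>k. \<nexists>u. ctl (\<sigma> l p) = Waiting u"
  proof (cases "\<exists>u. ctl (\<sigma> k p) = Waiting u")
    case True
    then obtain l u v where l: "l \<ge> k" "\<alpha> l = Return p (Upd u) v" using waiting_ends[OF p] by blast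
    then have "lstep D out p (\<sigma> l p) (\<alpha> l) (\<sigma> (Suc l) p)" using actor_lstep[OF p, of l] by simp
    then have "ctl (\<sigma> (Suc l) p) = Idle" by cases (use l in auto)
    with l show ?thesis by (intro exI[of _ "Suc l"]) simp
  qed blast
  then obtain l where l: "l \<ge> k" "\<nexists>u. ctl (\<sigma> l p) = Waiting u" by blast
  then have "pre (part p (view p)) l = pre (returns p) l"
    unfolding pre_part_view_returns[OF p] by (simp split: control.splits)
  then show "\<exists>l. prefix (pre (part p (view p)) k) (pre (returns p) l)"
    using prefix_pre[OF l(1)] by metis
qed

text \<open>Masking erases queries and values, the only things in which the views of two processes
  could differ on \<open>j\<close> beyond the counter.\<close>

lemma pre_masked_view:
  assumes q: "q \<notin> Byz"
  shows "pre (\<lambda>k. Option.bind (part j (view q) k) mask) k =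
    map (\<lambda>n. (Upd (msg j n), None, j)) [1..<Suc (del (\<sigma> k q) j)]"
proof (induction k)
  case 0
  then show ?case using initial[OF q] by (simp add: init_def)
next
  case (Suc k)
  show ?case
  proof (cases "\<exists>i n u. \<alpha> k = Process q i n u")
    case True
    then obtain i n u where e: "\<alpha> k = Process q i n u" by blast
    show ?thesis
      using Suc process_step[OF q e] process_msg[OF q e] by (simp add: pre_Suc part_def view_def e)
  next
    case False
    then have "Option.bind (part j (view q) k) mask = None"
      by (auto simp: part_def view_def split: event.splits operation.splits)
    with Suc False no_process_step(2)[OF q, of k] show ?thesis by (simp add: pre_Suc)
  qed
qed

text \<open>\<open>catch_up\<close> in both directions makes the prefixes dominate each
  other.\<close>

lemma compress_masked_view:
  assumes p: "p \<notin> Byz" and q: "q \<notin> Byz"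
  shows "compress (\<lambda>k. Option.bind (part j (view q) k) mask) =
    compress (\<lambda>k. Option.bind (part j (view p) k) mask)"
proof (rule compress_cong; unfold pre_masked_view[OF p] pre_masked_view[OF q])
  fix k
  show "\<exists>l. prefix (map (\<lambda>n. (Upd (msg j n), None, j)) [1..<Suc (del (\<sigma> k q) j)])
    (map (\<lambda>n. (Upd (msg j n), None, j)) [1..<Suc (del (\<sigma> l p) j)])"
    using catch_up[OF q p, of k] prefix_map_upt by blast
  show "\<exists>l. prefix (map (\<lambda>n. (Upd (msg j n), None, j)) [1..<Suc (del (\<sigma> k p) j)])
    (map (\<lambda>n. (Upd (msg j n), None, j)) [1..<Suc (del (\<sigma> l q) j)])"
    using catch_up[OF p q, of k] prefix_map_upt by blast
qed

section \<open>The mock history and how it is perceived\<close>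

lemma masked_view_other: "j \<noteq> p \<Longrightarrow> Option.bind (part j (view p) k) mask = part j (view p) k"
  by (auto simp: part_def view_def split: event.splits operation.splits)

definition mock :: "'p \<Rightarrow> ('p, 'u, 'v) history" where
  "mock r j = (if j \<in> Byz then compress (part j (view r)) else history_of \<alpha> j)"

text \<open>Both cases of \<open>mock\<close> take one form: \<open>q\<close> is \<open>r\<close>
  for a Byzantine \<open>j\<close> and \<open>j\<close> itself for a correct one.\<close>

lemma mock_view:
  assumes "r \<notin> Byz"
  shows "\<exists>q. q \<notin> Byz \<and> mock r j = compress (part j (view q))"
  using assms unfolding mock_def history_returns by (auto simp: compress_returns)

text \<open>All local sequences perceived by \<open>p\<close> become projections of the single
  timeline \<open>view p\<close>, as \<open>serialization_compress\<close> requires.\<close>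

lemma perceived_mock:
  assumes r: "r \<notin> Byz" and p: "p \<notin> Byz"
  shows "perceived p (mock r) = (\<lambda>j. compress (part j (view p)))"
proof
  fix j
  show "perceived p (mock r) j = compress (part j (view p))"
  proof (cases "j = p")
    case True
    then show ?thesis using p by (simp add: perceived_def mock_def history_returns compress_returns)
  next
    case False
    obtain q where q: "q \<notin> Byz" "mock r j = compress (part j (view q))" using mock_view[OF r] by blast
    have "perceived p (mock r) j = compress (\<lambda>k. Option.bind (compress (part j (view q)) k) mask)"
      using False q(2) by (simp add: perceived_def)
    also have "\<dots> = compress (\<lambda>k. Option.bind (part j (view q) k) mask)" by (rule compress_bind_compress)
    also have "\<dots> = compress (\<lambda>k. Option.bind (part j (view p) k) mask)"
      by (rule compress_masked_view[OF p q(1)])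
    finally show ?thesis by (simp add: masked_view_other[OF False])
  qed
qed

lemma view_process:
  assumes p: "p \<notin> Byz" and v: "view p k = Some (Upd u, val, j)"
  shows "authorized D (j, u)"
  using v process_step(2)[OF p, of k]
  by (auto simp: view_def split: event.split_asm operation.split_asm if_split_asm)

lemma mock_history_mock:
  assumes r: "r \<notin> Byz"
  shows "mock_history D Byz (history_of \<alpha>) (mock r)"
proof -
  have "mock_local_history D j (mock r j)" if j: "j \<in> Byz" for j
    unfolding mock_local_history_def
  proof (intro conjI allI impI)
    show "is_seq (mock r j)" using j by (simp add: mock_def is_seq_compress)
    fix k op val q assume "mock r j k = Some (op, val, q)"
    then obtain i where i: "view r i = Some (op, val, q)" "q = j"
      using j by (auto simp: mock_def compress_eq_Some_iff)
    then show "q = j" by blast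
    \<comment> \<open>The view of \<open>r\<close> contains queries of \<open>r\<close> only, so an
      entry of \<open>j\<close> is an update.\<close>
    have "j \<noteq> r" using r j by auto
    then obtain u where "op = Upd u"
      using i by (auto simp: view_def split: event.split_asm operation.split_asm if_split_asm)
    then show "op \<in> Upd ` (own D j \<union> common D)"
      using view_process[OF r, of i u val q] i by (auto simp: authorized_def)
  qed
  then show ?thesis by (simp add: mock_history_def mock_def)
qed

lemma updates_view:
  assumes p: "p \<notin> Byz"
  shows "List.map_filter (\<lambda>e. case e of (Upd u, _) \<Rightarrow> Some u | _ \<Rightarrow> None) (pre (view p) k) = seqv (\<sigma> k p)"
proof (induction k)
  case 0
  then show ?case using initial[OF p] by (simp add: init_def List.map_filter_simps)
next
  case (Suc k)
  show ?case
  proof (cases "\<exists>i n u. \<alpha> k = Process p i n u")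
    case True
    then obtain i n u where e: "\<alpha> k = Process p i n u" by blast
    show ?thesis
      using Suc process_step(5)[OF p e]
      by (simp add: pre_Suc view_def e map_filter_append List.map_filter_simps)
  next
    case False
    then have "\<nexists>u x. view p k = Some (Upd u, x)"
      by (auto simp: view_def split: event.split_asm operation.split_asm if_split_asm)
    with Suc False no_process_step(1)[OF p, of k] show ?thesis
      by (auto simp: pre_Suc map_filter_append List.map_filter_simps
          split: option.splits operation.splits)
  qed
qed

text \<open>The updates before any entry of the view form the sequence \<open>seqv\<close> at the
  event of that entry; this sequence is in the language, and the values were computed from
  it.\<close>

lemma legal_view:
  assumes p: "p \<notin> Byz"
  shows "pco_legal D out (compress (view p))"
proof -
  have upd: "\<exists>l. updates_before (compress (view p)) k = seqv (\<sigma> l p)" for k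
    using pre_compress[of "view p" k] by (auto simp: updates_before_pre updates_view[OF p])
  have val: "\<exists>l. view p l = Some e \<and> updates_before (compress (view p)) k = seqv (\<sigma> l p)"
    if "compress (view p) k = Some e" for k e
    using pre_compress_Some[OF that] by (auto simp: updates_before_pre updates_view[OF p])
  have query: "j = p \<and> q \<in> queries D \<and> val = Some (q (trc D (seqv (\<sigma> l p))))"
    if v: "view p l = Some (Qry q, val, j)" for l q val j
  proof -
    obtain v where e: "\<alpha> l = Return p (Qry q) v" "val = Some v" "j = p"
      using v by (auto simp: view_def split: event.split_asm operation.split_asm if_split_asm)
    have "lstep D out p (\<sigma> l p) (\<alpha> l) (\<sigma> (Suc l) p)" using actor_lstep[OF p, of l] e by simp
    then have "v = q (trc D (seqv (\<sigma> l p)))" by cases (use e in auto)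
    then show ?thesis using e return_ops[OF p e(1)] by (auto simp: ops_of_def)
  qed
  show ?thesis
    unfolding pco_legal_def
  proof (intro conjI allI impI)
    fix k show "trc D (updates_before (compress (view p)) k) \<in> lang D"
      using upd[of k] seqv_lang[OF p] by auto
  next
    fix k op val j assume "compress (view p) k = Some (op, val, j)"
    then obtain l where l: "view p l = Some (op, val, j)" using val by blast
    show "op \<in> ops_of D j"
    proof (cases op)
      case (Upd u)
      then show ?thesis using view_process[OF p, of l u val j] l by (auto simp: ops_of_def authorized_def)
    next
      case (Qry q)
      then show ?thesis using query[of l q val j] l by (auto simp: ops_of_def)
    qed
  next
    fix k q val j assume "compress (view p) k = Some (Qry q, val, j)"
    from val[OF this] obtain l where "view p l = Some (Qry q, val, j)"
      "updates_before (compress (view p)) k = seqv (\<sigma> l p)" by blast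
    with query show "val = Some (q (trc D (updates_before (compress (view p)) k)))" by simp
  next
    fix k u val j assume "compress (view p) k = Some (Upd u, val, j)" "val \<noteq> None"
    moreover from val[OF this(1)] obtain l where "view p l = Some (Upd u, val, j)"
      "updates_before (compress (view p)) k = seqv (\<sigma> l p)" by blast
    ultimately show "val = Some (out u (trc D (updates_before (compress (view p)) k)))"
      by (auto simp: view_def split: event.split_asm operation.split_asm if_split_asm)
  qed
qed

end

theorem theorem2:
  fixes D :: "('p::finite, 'u, 'v) pco"
    and out :: "'u \<Rightarrow> 'u trace \<Rightarrow> 'v"
    and t :: nat
    and Byz :: "'p set"
    and \<sigma> :: "nat \<Rightarrow> 'p \<Rightarrow> ('p, 'u, 'v, 'm) lstate"
    and \<alpha> :: "nat \<Rightarrow> ('p, 'u, 'v, 'm) event"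
  assumes "pco_spec D"
    and "real t < real CARD('p) / 3"
    and "card Byz \<le> t"
    and "execution D out Byz \<sigma> \<alpha>"
  shows "(\<forall>p. p \<notin> Byz \<longrightarrow> (\<forall>k. provides_ops D out p (\<sigma> k p)))
    \<and> (\<forall>p. p \<notin> Byz \<longrightarrow> local_history D p (history_of \<alpha> p))
    \<and> (\<forall>p. p \<notin> Byz \<longrightarrow> ops_terminate p \<alpha>)
    \<and> (\<exists>H'. mock_history D Byz (history_of \<alpha>) H' \<and>
         (\<forall>p. p \<notin> Byz \<longrightarrow> (\<exists>S. serialization (perceived p H') S \<and> pco_legal D out S)))"
proof -
  interpret algorithm_run D out Byz \<sigma> \<alpha> using assms(1,4) by unfold_locales
  \<comment> \<open>Some process is correct; it serves as the reference \<open>r\<close> for the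
    mock history.\<close>
  have "card Byz < CARD('p)" using assms(2,3) by linarith
  then have "Byz \<noteq> UNIV" by auto
  then obtain r where r: "r \<notin> Byz" by blast
  have "serialization (perceived p (mock r)) (compress (view p))" if "p \<notin> Byz" for p
    unfolding perceived_mock[OF r that] by (rule serialization_compress)
  then show ?thesis
    using provides local_history_returns operations_terminate mock_history_mock[OF r] legal_view by blast
qed

end
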